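(* (Team variance difference formula.) Consider the $n$-player stochastic game with separately controlled chains described in the context. For any two stationary deterministic policies $u=(u_1,\dots,u_n)$ and $u'=(u'_1,\dots,u'_n)$ in $\mathcal U^{\rm SD}$, $$J^{u'}_\sigma-J^u_\sigma=\sum_{i=1}^n\boldsymbol\pi_i^{u'_i}\Big[(\boldsymbol P_i^{u'_i}-\boldsymbol P_i^{u_i})\boldsymbol g_i^{u_i}+(\boldsymbol r_i^{u'_i}-\mu^u\boldsymbol 1)^2_\odot-(\boldsymbol r_i^{u_i}-\mu^u\boldsymbol 1)^2_\odot\Big]-n(\mu^{u'}-\mu^u)^2,$$ where $\boldsymbol g_i^{u_i}$ is the performance potential of player $i$ under $u_i$ for the cost $(r_i-y)^2$ with $y=\mu^u$.
   Context: Game. There are players $\mathcal I=\{1,\dots,n\}$. Player $i$ has a finite state space $\mathcal S_i$ and a finite action space $\mathcal A_i$. Time is discrete, $t=0,1,2,\dots$; the state and action of player $i$ at time $t$ are $s_{i,t}$, $a_{i,t}$. Separately controlled chains: player $i$'s state moves according to a transition probability $p_i(s_i'\mid s_i,a_i)$ depending only on its own state and action, player $i$'s reward is $r_i(s_i,a_i)\in\mathbb R$, and the joint transition probability is $\prod_{i=1}^n p_i(s_i'\mid s_i,a_i)$. $\mathcal U_i^{\rm SD}$ is the set of stationary deterministic policies of player $i$, i.e. maps $u_i:\mathcal S_i\to\mathcal A_i$ with $a_{i,t}=u_i(s_{i,t})$, and $\mathcal U^{\rm SD}=\times_{i=1}^n\mathcal U_i^{\rm SD}$. Standing assumption: for every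 $i$ and $u_i\in\mathcal U_i^{\rm SD}$ the Markov chain on $\mathcal S_i$ with transition probabilities $p_i(s'\mid s,u_i(s))$ is ergodic (irreducible and aperiodic). Criterion. The team mean and team variance under $u$ are $$\mu^u=\mathbb E^u\Big\{\frac1n\sum_{i=1}^n\lim_{T\to\infty}\frac1T\sum_{t=0}^{T-1}r_i(s_{i,t},a_{i,t})\Big\},\qquad J^u_\sigma=\mathbb E^u\Big\{\sum_{i=1}^n\lim_{T\to\infty}\frac1T\sum_{t=0}^{T-1}[r_i(s_{i,t},a_{i,t})-\mu^u]^2\Big\}.$$ Vector notation. For $u_i\in\mathcal U_i^{\rm SD}$: $\boldsymbol P_i^{u_i}$ is the matrix with entries $p_i(s'\mid s,u_i(s))$, $s,s'\in\mathcal S_i$; $\boldsymbol\pi_i^{u_i}$ is the row vector of its stationary distribution; $\boldsymbol r_i^{u_i}$ is the column vector with entries $r_i(s,u_i(s))$; $\boldsymbol 1$ is the all-ones column vector; $(\cdot)^2_\odot$ is the elementwise square. The performance potential of player $i$ under $u_i$ (for parameter $y\in\mathbb R$) is the column vector $\boldsymbol g_i^{u_i}$ with entries $$g_i^{u_i}(s)=\mathbb E\Big\{\sum_{t=0}^\infty\big([r_i(s_{i,t},a_{i,t})-y]^2-J^{u_i}_{\sigma,i}(y)\big)\,\Big|\,s_{i,0}=s\Big\},\qquad s\in\mathcal S_i,\ a_{i,t}=u_i(s_{i,t}),$$ where $J^{u_i}_{\sigma,i}(y)=\mathbb E^{u_i}\{\lim_{T\to\infty}\frac1T\sum_{t=0}^{T-1}[r_i(s_{i,t},a_{i,t})-y]^2\}$.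 The infinite sum is understood as the limit of the expectations of its partial sums. *)

theory Defs
  imports "HOL-Probability.Probability"
begin

section \<open>Markov chains\<close>

text \<open>
  A Markov chain has transition kernel \<open>K :: 'x \<Rightarrow> 'x pmf\<close>; a finite state space is represented by
  a finite set \<open>S\<close> that is closed under \<open>K\<close>. The law of the chain on trajectories \<open>nat \<Rightarrow> 'x\<close> is the
  Ionescu-Tulcea measure whose time-\<open>t\<close> kernel is the initial law for \<open>t = 0\<close> and
  \<open>K (\<omega> (t - 1))\<close> for \<open>t > 0\<close>.
\<close>

definition step_kernel :: "'x pmf \<Rightarrow> ('x \<Rightarrow> 'x pmf) \<Rightarrow> nat \<Rightarrow> (nat \<Rightarrow> 'x) \<Rightarrow> 'x measure" where
  "step_kernel \<nu> K t \<omega> = measure_pmf (case t of 0 \<Rightarrow> \<nu> | Suc k \<Rightarrow> K (\<omega> k))"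

lemma Ionescu_Tulcea_step_kernel:
  "Ionescu_Tulcea (step_kernel \<nu> K) (\<lambda>_. count_space UNIV)"
proof (rule Ionescu_Tulcea.intro)
  fix t :: nat
  show "step_kernel \<nu> K t \<in> measurable (PiM {0..<t} (\<lambda>_. count_space UNIV))
      (subprob_algebra (count_space UNIV))"
  proof (cases t)
    case 0
    then show ?thesis
      by (auto simp: step_kernel_def[abs_def] space_subprob_algebra measure_pmf.subprob_space_axioms
               intro!: measurable_const)
  next
    case (Suc k)
    have "(\<lambda>\<omega>. measure_pmf (K (\<omega> k))) \<in> measurable (PiM {0..<t} (\<lambda>_. count_space UNIV))
        (subprob_algebra (count_space UNIV))"
      by (rule measurable_compose[of "\<lambda>\<omega>. \<omega> k" _ "count_space UNIV"])
         (auto simp: Suc space_subprob_algebra measure_pmf.subprob_space_axioms)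
    then show ?thesis
      by (simp add: step_kernel_def[abs_def] Suc)
  qed
next
  fix t \<omega>
  show "prob_space (step_kernel \<nu> K t \<omega>)"
    by (simp add: step_kernel_def measure_pmf.prob_space_axioms)
qed

definition markov_law :: "'x pmf \<Rightarrow> ('x \<Rightarrow> 'x pmf) \<Rightarrow> (nat \<Rightarrow> 'x) measure" where
  "markov_law \<nu> K = projective_family.lim UNIV
     (Ionescu_Tulcea.CI (step_kernel \<nu> K) (\<lambda>_. count_space UNIV)) (\<lambda>_. count_space UNIV)"

lemma
  shows prob_space_markov_law: "prob_space (markov_law \<nu> K)"
    and sets_markov_law: "sets (markov_law \<nu> K) = sets (PiM UNIV (\<lambda>_. count_space UNIV))"
    and space_markov_law: "space (markov_law \<nu> K) = UNIV"
proof -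
  interpret IT: Ionescu_Tulcea "step_kernel \<nu> K" "\<lambda>_. count_space UNIV"
    by (rule Ionescu_Tulcea_step_kernel)
  show "sets (markov_law \<nu> K) = sets (PiM UNIV (\<lambda>_. count_space UNIV))"
    by (simp add: markov_law_def)
  show sp: "space (markov_law \<nu> K) = UNIV"
    by (simp add: markov_law_def space_PiM)
  have "distr (markov_law \<nu> K) (PiM {} (\<lambda>_. count_space UNIV)) (\<lambda>x. restrict x {}) = IT.CI {}"
    unfolding markov_law_def by (rule IT.distr_lim) simp
  moreover have "prob_space (IT.CI {})"
    by (rule IT.PF.prob_space_P) auto
  moreover have "(\<lambda>x. restrict x {}) \<in> measurable (markov_law \<nu> K) (PiM {} (\<lambda>_. count_space UNIV))"
    by (rule measurable_restrict) simp
  ultimately show "prob_space (markov_law \<nu> K)"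
    by (metis prob_space_distrD)
qed

lemma emeasure_markov_law_cylinder:
  "emeasure (markov_law \<nu> K) {\<omega>. \<forall>k\<le>t. \<omega> k = x k} =
    ennreal (pmf \<nu> (x 0) * (\<Prod>k<t. pmf (K (x k)) (x (Suc k))))"
proof -
  interpret IT: Ionescu_Tulcea "step_kernel \<nu> K" "\<lambda>_. count_space UNIV"
    by (rule Ionescu_Tulcea_step_kernel)
  let ?M = "\<lambda>m. PiM {0..<m} (\<lambda>_::nat. count_space (UNIV :: 'a set))"
  let ?B = "\<lambda>m. {\<omega> \<in> space (?M m). \<forall>k<m. \<omega> k = x k}"
  let ?q = "\<lambda>m. \<Prod>k<m. pmf (case k of 0 \<Rightarrow> \<nu> | Suc j \<Rightarrow> K (x j)) (x k)"
  have B: "?B m \<in> sets (?M m)" for m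
  proof -
    have "?B m = (\<Pi>\<^sub>E k\<in>{0..<m}. {x k})"
      by (auto simp: space_PiM PiE_iff extensional_def)
    then show ?thesis
      by (auto intro!: sets_PiM_I_finite)
  qed
  have C: "emeasure (IT.C 0 m (\<lambda>_. undefined)) (?B m) = ennreal (?q m)" for m
  proof (induction m)
    case 0
    then show ?case
      using B[of 0] by (simp add: emeasure_return space_PiM)
  next
    case (Suc m)
    have u: "(\<lambda>_. undefined) \<in> space (?M 0)"
      by (simp add: space_PiM)
    have sp: "space (IT.C 0 m (\<lambda>_. undefined)) = space (?M m)"
      using IT.space_C[OF u, of m] by simp
    have st: "sets (IT.C 0 m (\<lambda>_. undefined)) = sets (?M m)"
      using IT.sets_C[OF u, of m] by simp
    have ne: "space (IT.C 0 m (\<lambda>_. undefined)) \<noteq> {}"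
      using prob_space.not_empty[OF IT.prob_space_C[OF u]] .
    have eP: "IT.eP m \<in> measurable (IT.C 0 m (\<lambda>_. undefined)) (subprob_algebra (?M (Suc m)))"
      using IT.measurable_eP[of m] by (simp add: measurable_cong_sets[OF st refl])
    have *: "emeasure (IT.eP m \<omega>) (?B (Suc m)) =
        ennreal (pmf (case m of 0 \<Rightarrow> \<nu> | Suc j \<Rightarrow> K (x j)) (x m)) * indicator (?B m) \<omega>"
      if \<omega>: "\<omega> \<in> space (?M m)" for \<omega>
    proof -
      have "(\<lambda>y. fun_upd \<omega> m y) -` ?B (Suc m) \<inter> space (count_space UNIV) =
          (if \<omega> \<in> ?B m then {x m} else {})"
        using \<omega> by (auto simp: space_PiM PiE_iff extensional_def less_Suc_eq)
      then show ?thesis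
        using IT.emeasure_eP[OF \<omega> B[of "Suc m"]] \<omega>
        by (cases m) (auto simp: step_kernel_def emeasure_pmf_single)
    qed
    have "emeasure (IT.C 0 (Suc m) (\<lambda>_. undefined)) (?B (Suc m)) =
        (\<integral>\<^sup>+\<omega>. emeasure (IT.eP m \<omega>) (?B (Suc m)) \<partial>IT.C 0 m (\<lambda>_. undefined))"
      by (simp del: space_PiM add: emeasure_bind[OF ne eP B])
    also have "\<dots> = (\<integral>\<^sup>+\<omega>. ennreal (pmf (case m of 0 \<Rightarrow> \<nu> | Suc j \<Rightarrow> K (x j)) (x m)) *
        indicator (?B m) \<omega> \<partial>IT.C 0 m (\<lambda>_. undefined))"
      by (rule nn_integral_cong) (simp only: sp *)
    also have "\<dots> = ennreal (?q (Suc m))"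
      using B[of m] Suc.IH
      by (subst nn_integral_cmult_indicator) (simp_all add: st ennreal_mult'' prod_nonneg mult.commute)
    finally show ?case .
  qed
  have "{\<omega>. \<forall>k\<le>t. \<omega> k = x k} = prod_emb UNIV (\<lambda>_. count_space UNIV) {0..<Suc t} (?B (Suc t))"
    by (auto simp: prod_emb_def space_PiM less_Suc_eq_le)
  then have "emeasure (markov_law \<nu> K) {\<omega>. \<forall>k\<le>t. \<omega> k = x k} = emeasure (IT.CI {0..<Suc t}) (?B (Suc t))"
    unfolding markov_law_def using IT.lim[OF _ B[of "Suc t"]] by simp
  also have "\<dots> = emeasure (IT.C 0 (Suc t) (\<lambda>_. undefined)) (?B (Suc t))"
  proof -
    have "prod_emb {0..<Suc t} (\<lambda>_. count_space UNIV) {0..<Suc t} (?B (Suc t)) = ?B (Suc t)"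
      by (rule prod_emb_id) (auto simp: space_PiM)
    then show ?thesis
      using IT.emeasure_CI[OF order_refl B[of "Suc t"]] by simp
  qed
  also have "\<dots> = ennreal (?q (Suc t))"
    by (rule C)
  also have "?q (Suc t) = pmf \<nu> (x 0) * (\<Prod>k<t. pmf (K (x k)) (x (Suc k)))"
    by (subst prod.lessThan_Suc_shift) simp
  finally show ?thesis .
qed

fun nstep :: "('x \<Rightarrow> 'x pmf) \<Rightarrow> nat \<Rightarrow> 'x \<Rightarrow> 'x pmf" where
  "nstep K 0 x = return_pmf x"
| "nstep K (Suc t) x = bind_pmf (nstep K t x) K"

definition irreducible_chain :: "'x set \<Rightarrow> ('x \<Rightarrow> 'x pmf) \<Rightarrow> bool" where
  "irreducible_chain S K \<longleftrightarrow> (\<forall>x\<in>S. \<forall>y\<in>S. \<exists>t. pmf (nstep K t x) y > 0)"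

definition aperiodic_chain :: "'x set \<Rightarrow> ('x \<Rightarrow> 'x pmf) \<Rightarrow> bool" where
  "aperiodic_chain S K \<longleftrightarrow> (\<forall>x\<in>S. Gcd {t. t > 0 \<and> pmf (nstep K t x) x > 0} = (1::nat))"

definition ergodic_chain :: "'x set \<Rightarrow> ('x \<Rightarrow> 'x pmf) \<Rightarrow> bool" where
  "ergodic_chain S K \<longleftrightarrow> irreducible_chain S K \<and> aperiodic_chain S K"

text \<open>Well-defined for finite closed \<open>S\<close> on which \<open>K\<close> is irreducible.\<close>

definition stationary_dist :: "'x set \<Rightarrow> ('x \<Rightarrow> 'x pmf) \<Rightarrow> 'x pmf" where
  "stationary_dist S K =
    (THE \<pi>. set_pmf \<pi> \<subseteq> S \<and> (\<forall>y\<in>S. (\<Sum>x\<in>S. pmf \<pi> x * pmf (K x) y) = pmf \<pi> y))"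

definition long_run_average :: "(nat \<Rightarrow> real) \<Rightarrow> real" where
  "long_run_average f = lim (\<lambda>T. 1 / real T * (\<Sum>t<T. f t))"


section \<open>A single player\<close>

text \<open>
  Throughout, \<open>q s a\<close> is the law of the next state, \<open>\<rho> s a\<close> the reward and \<open>f\<close> a stationary
  deterministic policy. The pathwise limit in \<open>player_variance\<close> does not depend on the initial
  state when the chain is ergodic; the potential conditions on \<open>s\<^sub>0 = s\<close> throughout, so
  that state is used for both.
\<close>

definition policy_kernel :: "('s \<Rightarrow> 'a \<Rightarrow> 's pmf) \<Rightarrow> ('s \<Rightarrow> 'a) \<Rightarrow> 's \<Rightarrow> 's pmf" where
  "policy_kernel q f s = q s (f s)"

definition player_variance ::
    "('s \<Rightarrow> 'a \<Rightarrow> 's pmf) \<Rightarrow> ('s \<Rightarrow> 'a \<Rightarrow> real) \<Rightarrow> ('s \<Rightarrow> 'a) \<Rightarrow> real \<Rightarrow> 's \<Rightarrow> real" where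
  "player_variance q \<rho> f y s =
    (\<integral>\<omega>. long_run_average (\<lambda>t. (\<rho> (\<omega> t) (f (\<omega> t)) - y)\<^sup>2)
      \<partial>markov_law (return_pmf s) (policy_kernel q f))"

definition potential ::
    "('s \<Rightarrow> 'a \<Rightarrow> 's pmf) \<Rightarrow> ('s \<Rightarrow> 'a \<Rightarrow> real) \<Rightarrow> ('s \<Rightarrow> 'a) \<Rightarrow> real \<Rightarrow> 's \<Rightarrow> real" where
  "potential q \<rho> f y s =
    lim (\<lambda>N. \<integral>\<omega>. (\<Sum>t<N. ((\<rho> (\<omega> t) (f (\<omega> t)) - y)\<^sup>2 - player_variance q \<rho> f y s))
      \<partial>markov_law (return_pmf s) (policy_kernel q f))"


section \<open>The team\<close>

text \<open>
  The players are \<open>1, \<dots>, n\<close>. The finite state and action spaces of player \<open>i\<close> are subsets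
  \<open>S i\<close> and \<open>A i\<close> of common types, which does not restrict them. Joint states and joint policies
  are indexed by \<open>{1..n}\<close>; \<open>\<nu>\<close> is the law of the initial joint state.
\<close>

definition joint_kernel ::
    "nat \<Rightarrow> (nat \<Rightarrow> 's \<Rightarrow> 'a \<Rightarrow> 's pmf) \<Rightarrow> (nat \<Rightarrow> 's \<Rightarrow> 'a) \<Rightarrow> (nat \<Rightarrow> 's) \<Rightarrow> (nat \<Rightarrow> 's) pmf" where
  "joint_kernel n p u x = Pi_pmf {1..n} undefined (\<lambda>i. p i (x i) (u i (x i)))"

definition team_law ::
    "nat \<Rightarrow> (nat \<Rightarrow> 's \<Rightarrow> 'a \<Rightarrow> 's pmf) \<Rightarrow> (nat \<Rightarrow> 's) pmf \<Rightarrow> (nat \<Rightarrow> 's \<Rightarrow> 'a)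
      \<Rightarrow> (nat \<Rightarrow> nat \<Rightarrow> 's) measure" where
  "team_law n p \<nu> u = markov_law \<nu> (joint_kernel n p u)"

definition team_mean ::
    "nat \<Rightarrow> (nat \<Rightarrow> 's \<Rightarrow> 'a \<Rightarrow> 's pmf) \<Rightarrow> (nat \<Rightarrow> 's \<Rightarrow> 'a \<Rightarrow> real) \<Rightarrow> (nat \<Rightarrow> 's) pmf
      \<Rightarrow> (nat \<Rightarrow> 's \<Rightarrow> 'a) \<Rightarrow> real" where
  "team_mean n p r \<nu> u =
    (\<integral>\<omega>. 1 / real n * (\<Sum>i=1..n. long_run_average (\<lambda>t. r i (\<omega> t i) (u i (\<omega> t i))))
      \<partial>team_law n p \<nu> u)"

definition team_variance ::
    "nat \<Rightarrow> (nat \<Rightarrow> 's \<Rightarrow> 'a \<Rightarrow> 's pmf) \<Rightarrow> (nat \<Rightarrow> 's \<Rightarrow> 'a \<Rightarrow> real) \<Rightarrow> (nat \<Rightarrow> 's) pmf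
      \<Rightarrow> (nat \<Rightarrow> 's \<Rightarrow> 'a) \<Rightarrow> real" where
  "team_variance n p r \<nu> u =
    (\<integral>\<omega>. (\<Sum>i=1..n. long_run_average
        (\<lambda>t. (r i (\<omega> t i) (u i (\<omega> t i)) - team_mean n p r \<nu> u)\<^sup>2))
      \<partial>team_law n p \<nu> u)"

definition SD_policies ::
    "nat \<Rightarrow> (nat \<Rightarrow> 's set) \<Rightarrow> (nat \<Rightarrow> 'a set) \<Rightarrow> (nat \<Rightarrow> 's \<Rightarrow> 'a) set" where
  "SD_policies n S A = (\<Pi>\<^sub>E i\<in>{1..n}. S i \<rightarrow>\<^sub>E A i)"

end

theory Submission
  imports Defs "HOL-Library.Discrete_Functions"
begin

text \<open>
  Write \<open>c\<^sub>i(s) = (r\<^sub>i(s, u\<^sub>i(s)) - \<mu>)\<^sup>2\<close> with \<open>\<mu>\<close> the team mean under \<open>u\<close>, let \<open>c\<^sub>i'\<close> be the same cost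
  with \<open>u'\<close> in place of \<open>u\<close> and the same \<open>\<mu>\<close>, and let \<open>\<pi>\<^sub>i\<close>, \<open>\<pi>\<^sub>i'\<close> be the stationary
  distributions. Three facts give the formula.

  First, all long-run averages are almost surely constant: the average of a function of player \<open>i\<close>'s
  state is its mean under the stationary distribution, so the team mean and variance are finite sums
  of stationary expectations (\<open>team_mean_eq\<close>, \<open>team_variance_eq\<close>). For a fixed cost \<open>(r - y)\<^sup>2\<close> the
  parallel-axis identity gives the variance as the sum of the mean costs minus \<open>n\<close> times the squared
  distance of \<open>y\<close> from the team mean (\<open>team_variance_shift\<close>). Taking \<open>y = \<mu>\<close> and the policy \<open>u'\<close> decouples the players and leaves
  exactly the quadratic correction of the theorem.

  Second, the potential solves the Poisson equation \<open>c\<^sub>i - \<pi>\<^sub>i c\<^sub>i = g\<^sub>i - P\<^sub>i g\<^sub>i\<close> (\<open>potential_Poisson\<close>).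
  Third, \<open>\<pi>\<^sub>i' P\<^sub>i' = \<pi>\<^sub>i'\<close>. Hence \<open>\<pi>\<^sub>i' [(P\<^sub>i' - P\<^sub>i) g\<^sub>i + c\<^sub>i' - c\<^sub>i] =
  \<pi>\<^sub>i' [g\<^sub>i - P\<^sub>i g\<^sub>i - c\<^sub>i] + \<pi>\<^sub>i' c\<^sub>i' = \<pi>\<^sub>i' c\<^sub>i' - \<pi>\<^sub>i c\<^sub>i\<close>, and summing over the players
  gives the formula.

  The Poisson equation also drives the probabilistic part. If \<open>F - \<eta> = H - K H\<close> on a finite closed
  set, the partial sums of \<open>F - \<eta>\<close> along a trajectory telescope into a bounded term plus a martingale
  with bounded increments, which is almost surely sublinear (\<open>ergodic_theorem\<close>). On the joint chain of
  all players this is used with \<open>F\<close> and \<open>H\<close> depending on a single coordinate, so that ergodicity of each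
  player's own chain gives the long-run averages of the team.
  Solutions of the Poisson equation come from geometric ergodicity of the individual chains
  (\<open>Poisson_solution\<close>), which is Doeblin's contraction argument applied to a power of the kernel that
  has only positive entries.
\<close>

section \<open>Trajectories of a finite chain\<close>

lemma measurable_markov_law_coord [measurable]:
  "(\<lambda>\<omega>. f (\<omega> t)) \<in> borel_measurable (markov_law \<nu> K)" for f :: "'x \<Rightarrow> real"
proof -
  have "(\<lambda>\<omega>. \<omega> t) \<in> measurable (markov_law \<nu> K) (count_space UNIV)"
    by (subst measurable_cong_sets[OF sets_markov_law refl]) simp
  then show ?thesis
    by (rule measurable_compose) simp
qed

lemma sets_cylinder: "{\<omega>. \<forall>k\<le>t. \<omega> k = x k} \<in> sets (markov_law \<nu> K)"
proof -
  have "(\<lambda>\<omega>. \<omega> k) \<in> measurable (markov_law \<nu> K) (count_space UNIV)" for k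
    by (subst measurable_cong_sets[OF sets_markov_law refl]) simp
  then have "(\<lambda>\<omega>. \<omega> k) -` {x k} \<inter> space (markov_law \<nu> K) \<in> sets (markov_law \<nu> K)" for k
    by (rule measurable_sets) simp
  then have "(\<Inter>k\<in>{..t}. {\<omega>. \<omega> k = x k}) \<in> sets (markov_law \<nu> K)"
    by (intro sets.finite_INT) (auto simp: space_markov_law vimage_def)
  moreover have "(\<Inter>k\<in>{..t}. {\<omega>. \<omega> k = x k}) = {\<omega>. \<forall>k\<le>t. \<omega> k = x k}"
    by auto
  ultimately show ?thesis by simp
qed

text \<open>
  The kernel is only constrained on \<open>S\<close>: the type of states may be uncountable and the kernel
  arbitrary elsewhere, as happens for joint states, which are functions.
\<close>

locale finite_chain =
  fixes S :: "'x set" and K :: "'x \<Rightarrow> 'x pmf"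
  assumes finite_S: "finite S"
    and closed: "x \<in> S \<Longrightarrow> set_pmf (K x) \<subseteq> S"
begin

lemma expectation_eq_sum:
  fixes f :: "'x \<Rightarrow> real"
  assumes "set_pmf p \<subseteq> S"
  shows "measure_pmf.expectation p f = (\<Sum>x\<in>S. pmf p x * f x)"
  using assms integral_measure_pmf_real[OF finite_S, of p f] by (auto simp: mult.commute)

definition paths :: "nat \<Rightarrow> (nat \<Rightarrow> 'x) set" where
  "paths t = {..t} \<rightarrow>\<^sub>E S"

definition path_prob :: "'x pmf \<Rightarrow> nat \<Rightarrow> (nat \<Rightarrow> 'x) \<Rightarrow> real" where
  "path_prob \<nu> t x = pmf \<nu> (x 0) * (\<Prod>k<t. pmf (K (x k)) (x (Suc k)))"

lemma finite_paths: "finite (paths t)"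
  by (simp add: paths_def finite_PiE finite_S)

text \<open>
  Summing out the last state of a path is one application of the kernel; this is the
  finite-dimensional form of the Markov property.
\<close>

lemma sum_paths_Suc:
  "(\<Sum>x\<in>paths (Suc t). path_prob \<nu> (Suc t) x * G x) =
    (\<Sum>x\<in>paths t. path_prob \<nu> t x * (\<Sum>y\<in>S. pmf (K (x t)) y * G (x(Suc t := y))))"
proof -
  have eq: "paths (Suc t) = (\<lambda>(y, x). x(Suc t := y)) ` (S \<times> paths t)"
    unfolding paths_def atMost_Suc by (subst PiE_insert_eq) simp
  have inj: "inj_on (\<lambda>(y, x). x(Suc t := y)) (S \<times> paths t)"
    unfolding paths_def by (rule inj_combinator) simp
  have prob: "path_prob \<nu> (Suc t) (x(Suc t := y)) = path_prob \<nu> t x * pmf (K (x t)) y" for x y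
    by (simp add: path_prob_def)
  have "(\<Sum>x\<in>paths (Suc t). path_prob \<nu> (Suc t) x * G x) =
      (\<Sum>(y, x)\<in>S \<times> paths t. path_prob \<nu> t x * (pmf (K (x t)) y * G (x(Suc t := y))))"
    unfolding eq by (subst sum.reindex[OF inj]) (simp add: prob case_prod_unfold mult.assoc)
  also have "\<dots> = (\<Sum>x\<in>paths t. \<Sum>y\<in>S. path_prob \<nu> t x * (pmf (K (x t)) y * G (x(Suc t := y))))"
    by (subst sum.cartesian_product [symmetric], rule sum.swap)
  finally show ?thesis
    by (simp add: sum_distrib_left)
qed

lemma sum_path_prob:
  assumes "set_pmf \<nu> \<subseteq> S"
  shows "(\<Sum>x\<in>paths t. path_prob \<nu> t x) = 1"
proof (induction t)
  case 0
  have eq: "paths 0 = (\<lambda>y k. if k = 0 then y else undefined) ` S"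
  proof -
    have "x = (\<lambda>k. if k = 0 then x 0 else undefined)" "x 0 \<in> S" if "x \<in> paths 0" for x
      using that by (auto simp: paths_def PiE_iff extensional_def)
    moreover have "(\<lambda>k. if k = 0 then y else undefined) \<in> paths 0" if "y \<in> S" for y
      using that by (auto simp: paths_def PiE_iff extensional_def split: if_splits)
    ultimately show ?thesis
      by blast
  qed
  have "inj_on (\<lambda>y k. if k = (0::nat) then y else undefined) S"
    by (rule inj_onI) (metis)
  then show ?case
    unfolding eq by (subst sum.reindex)
      (auto simp: path_prob_def sum_pmf_eq_1[OF finite_S assms])
next
  case (Suc t)
  have "x t \<in> S" if "x \<in> paths t" for x
    using that by (auto simp: paths_def)
  then have "(\<Sum>y\<in>S. pmf (K (x t)) y) = 1" if "x \<in> paths t" for x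
    using that sum_pmf_eq_1[OF finite_S closed] by auto
  then show ?case
    using sum_paths_Suc[of \<nu> t "\<lambda>_. 1"] Suc by simp
qed

lemma measure_cylinder:
  "measure (markov_law \<nu> K) {\<omega>. \<forall>k\<le>t. \<omega> k = x k} = path_prob \<nu> t x"
  by (simp add: measure_def emeasure_markov_law_cylinder path_prob_def prod_nonneg)

lemma AE_in_S:
  assumes "set_pmf \<nu> \<subseteq> S"
  shows "AE \<omega> in markov_law \<nu> K. \<forall>t. \<omega> t \<in> S"
proof (subst AE_all_countable, intro allI)
  fix t :: nat
  interpret prob_space "markov_law \<nu> K" by (rule prob_space_markov_law)
  let ?C = "\<lambda>x. {\<omega>. \<forall>k\<le>t. \<omega> k = x k}"
  let ?U = "\<Union>x\<in>paths t. ?C x"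
  have dis: "disjoint_family_on ?C (paths t)"
    unfolding disjoint_family_on_def
  proof (intro ballI impI)
    fix x y assume "x \<in> paths t" "y \<in> paths t" "x \<noteq> y"
    moreover from this obtain k where "x k \<noteq> y k" by auto
    ultimately show "?C x \<inter> ?C y = {}"
      by (cases "k \<le> t") (auto simp: paths_def PiE_iff extensional_def)
  qed
  have U: "?U \<in> events"
    using finite_paths by (intro sets.finite_UN sets_cylinder) auto
  have "prob ?U = (\<Sum>x\<in>paths t. prob (?C x))"
    by (rule finite_measure_finite_Union[OF finite_paths _ dis]) (auto intro: sets_cylinder)
  also have "\<dots> = 1"
    by (simp add: measure_cylinder sum_path_prob[OF assms])
  finally have "AE \<omega> in markov_law \<nu> K. \<omega> \<in> ?U"
    by (rule AE_prob_1)
  then show "AE \<omega> in markov_law \<nu> K. \<omega> t \<in> S"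
    by eventually_elim (auto simp: paths_def)
qed

text \<open>
  A function of the first \<open>t + 1\<close> states is almost surely a finite combination of cylinder
  indicators, because the chain stays in \<open>S\<close>. Measurability is a hypothesis because the product
  \<open>\<sigma>\<close>-algebra does not contain all sets of finite-horizon trajectories when the state type is uncountable.
\<close>

lemma
  fixes F :: "(nat \<Rightarrow> 'x) \<Rightarrow> real"
  assumes \<nu>: "set_pmf \<nu> \<subseteq> S"
    and meas: "F \<in> borel_measurable (markov_law \<nu> K)"
    and dep: "\<And>\<omega> x. (\<And>k. k \<le> t \<Longrightarrow> \<omega> k = x k) \<Longrightarrow> F \<omega> = F x"
  shows integrable_path: "integrable (markov_law \<nu> K) F"
    and integral_path: "(\<integral>\<omega>. F \<omega> \<partial>markov_law \<nu> K) = (\<Sum>x\<in>paths t. path_prob \<nu> t x * F x)"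
proof -
  interpret prob_space "markov_law \<nu> K" by (rule prob_space_markov_law)
  let ?C = "\<lambda>x. {\<omega>. \<forall>k\<le>t. \<omega> k = x k}"
  let ?G = "\<lambda>\<omega>. \<Sum>x\<in>paths t. indicator (?C x) \<omega> * F x"
  have ae: "AE \<omega> in markov_law \<nu> K. F \<omega> = ?G \<omega>"
    using AE_in_S[OF \<nu>]
  proof eventually_elim
    fix \<omega> :: "nat \<Rightarrow> 'x"
    assume \<omega>: "\<forall>t. \<omega> t \<in> S"
    let ?x = "restrict \<omega> {..t}"
    have "?x \<in> paths t" using \<omega> by (auto simp: paths_def)
    moreover have "indicator (?C x) \<omega> * F x = (if x = ?x then F \<omega> else 0)" if "x \<in> paths t" for x
    proof -
      have "\<omega> \<in> ?C x \<longleftrightarrow> x = ?x"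
        using that by (auto simp: paths_def PiE_iff extensional_def fun_eq_iff)
      moreover have "F ?x = F \<omega>" by (rule dep) auto
      ultimately show ?thesis by (auto simp: indicator_def)
    qed
    ultimately show "F \<omega> = ?G \<omega>"
      by (simp add: finite_paths)
  qed
  have int: "integrable (markov_law \<nu> K) ?G"
    by (intro Bochner_Integration.integrable_sum integrable_mult_left integrable_real_indicator
        sets_cylinder) (simp add: less_top[symmetric])
  show "integrable (markov_law \<nu> K) F"
    using integrable_cong_AE[OF meas borel_measurable_integrable[OF int] ae] int by simp
  have "(\<integral>\<omega>. F \<omega> \<partial>markov_law \<nu> K) = (\<integral>\<omega>. ?G \<omega> \<partial>markov_law \<nu> K)"
    by (rule integral_cong_AE[OF meas borel_measurable_integrable[OF int] ae])
  also have "\<dots> = (\<Sum>x\<in>paths t. path_prob \<nu> t x * F x)"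
    by (subst Bochner_Integration.integral_sum)
      (auto intro!: integrable_mult_left integrable_real_indicator sets_cylinder
         simp: measure_cylinder space_markov_law less_top[symmetric])
  finally show "(\<integral>\<omega>. F \<omega> \<partial>markov_law \<nu> K) = (\<Sum>x\<in>paths t. path_prob \<nu> t x * F x)" .
qed

lemma Markov_property:
  fixes F :: "(nat \<Rightarrow> 'x) \<Rightarrow> real"
  assumes \<nu>: "set_pmf \<nu> \<subseteq> S"
    and [measurable]: "F \<in> borel_measurable (markov_law \<nu> K)"
    and dep: "\<And>\<omega> x. (\<And>k. k \<le> t \<Longrightarrow> \<omega> k = x k) \<Longrightarrow> F \<omega> = F x"
  shows "(\<integral>\<omega>. F \<omega> * g (\<omega> (Suc t)) \<partial>markov_law \<nu> K) =
    (\<integral>\<omega>. F \<omega> * measure_pmf.expectation (K (\<omega> t)) g \<partial>markov_law \<nu> K)"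
proof -
  have "(\<integral>\<omega>. F \<omega> * g (\<omega> (Suc t)) \<partial>markov_law \<nu> K) =
      (\<Sum>x\<in>paths (Suc t). path_prob \<nu> (Suc t) x * (F x * g (x (Suc t))))"
  proof (rule integral_path[OF \<nu>])
    show "F \<omega> * g (\<omega> (Suc t)) = F x * g (x (Suc t))" if "\<And>k. k \<le> Suc t \<Longrightarrow> \<omega> k = x k" for \<omega> x
      using dep[of \<omega> x] that by auto
  qed measurable
  also have "\<dots> = (\<Sum>x\<in>paths t. path_prob \<nu> t x *
      (\<Sum>y\<in>S. pmf (K (x t)) y * (F (x(Suc t := y)) * g y)))"
    by (simp add: sum_paths_Suc)
  also have "\<dots> = (\<Sum>x\<in>paths t. path_prob \<nu> t x * (F x * measure_pmf.expectation (K (x t)) g))"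
  proof (intro sum.cong refl arg_cong2[where f = "(*)"])
    fix x assume "x \<in> paths t"
    then have "set_pmf (K (x t)) \<subseteq> S" by (intro closed) (auto simp: paths_def)
    moreover have "F (x(Suc t := y)) = F x" for y by (rule dep) auto
    ultimately show "(\<Sum>y\<in>S. pmf (K (x t)) y * (F (x(Suc t := y)) * g y)) =
        F x * measure_pmf.expectation (K (x t)) g"
      by (simp add: expectation_eq_sum sum_distrib_left mult_ac)
  qed
  also have "\<dots> = (\<integral>\<omega>. F \<omega> * measure_pmf.expectation (K (\<omega> t)) g \<partial>markov_law \<nu> K)"
  proof (rule integral_path[OF \<nu>, symmetric])
    show "F \<omega> * measure_pmf.expectation (K (\<omega> t)) g = F x * measure_pmf.expectation (K (x t)) g"
      if "\<And>k. k \<le> t \<Longrightarrow> \<omega> k = x k" for \<omega> x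
      using dep[of \<omega> x] that by auto
  qed measurable
  finally show ?thesis .
qed

lemma set_nstep: "x \<in> S \<Longrightarrow> set_pmf (nstep K t x) \<subseteq> S"
  by (induction t) (use closed in auto)

lemma expectation_bind:
  fixes f :: "'x \<Rightarrow> real"
  assumes "set_pmf p \<subseteq> S" "\<And>x. x \<in> S \<Longrightarrow> set_pmf (q x) \<subseteq> S"
  shows "measure_pmf.expectation (bind_pmf p q) f =
    measure_pmf.expectation p (\<lambda>x. measure_pmf.expectation (q x) f)"
  using pmf_expectation_bind[OF finite_S _ assms(1), of q f] assms finite_S
  by (auto simp: expectation_eq_sum intro: finite_subset)

lemma integral_coord:
  fixes f :: "'x \<Rightarrow> real"
  assumes "s \<in> S"
  shows "(\<integral>\<omega>. f (\<omega> t) \<partial>markov_law (return_pmf s) K) = measure_pmf.expectation (nstep K t s) f"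
proof (induction t arbitrary: f)
  case 0
  have "(\<integral>\<omega>. f (\<omega> 0) \<partial>markov_law (return_pmf s) K) =
      (\<integral>\<omega>. f s * indicator {\<omega>. \<forall>k\<le>0. \<omega> k = s} \<omega> \<partial>markov_law (return_pmf s) K)"
  proof (rule integral_cong_AE)
    interpret prob_space "markov_law (return_pmf s) K" by (rule prob_space_markov_law)
    have "AE \<omega> in markov_law (return_pmf s) K. \<omega> \<in> {\<omega>. \<forall>k\<le>0. \<omega> k = s}"
      by (rule AE_prob_1) (simp add: measure_cylinder path_prob_def del: le_zero_eq)
    then show "AE \<omega> in markov_law (return_pmf s) K.
        f (\<omega> 0) = f s * indicator {\<omega>. \<forall>k\<le>0. \<omega> k = s} \<omega>"
      by eventually_elim auto
  qed (use sets_cylinder[of 0 "\<lambda>_. s" "return_pmf s" K] in measurable)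
  also have "\<dots> = f s"
    using measure_cylinder[of "return_pmf s" 0 "\<lambda>_. s"]
    by (simp add: space_markov_law path_prob_def)
  finally show ?case by simp
next
  case (Suc t)
  have "(\<integral>\<omega>. 1 * f (\<omega> (Suc t)) \<partial>markov_law (return_pmf s) K) =
      (\<integral>\<omega>. 1 * measure_pmf.expectation (K (\<omega> t)) f \<partial>markov_law (return_pmf s) K)"
    using assms by (intro Markov_property) auto
  then show ?case
    using Suc[of "\<lambda>x. measure_pmf.expectation (K x) f"] assms
    by (simp add: expectation_bind set_nstep closed)
qed

end


section \<open>A strong law from the Poisson equation\<close>

text \<open>
  Consecutive squares \<open>k\<^sup>2\<close> and \<open>(k + 1)\<^sup>2\<close> differ by only \<open>2 k + 1\<close>, which is small relative to \<open>k\<^sup>2\<close>;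
  with bounded increments the values between two squares therefore follow those at the squares. Along
  the squares a variance bound that is linear in \<open>T\<close> is summable after division by \<open>T\<^sup>2\<close>.
\<close>

lemma tendsto_average_from_squares:
  fixes m :: "nat \<Rightarrow> real"
  assumes incr: "\<And>T. \<bar>m (Suc T) - m T\<bar> \<le> C"
    and sq: "(\<lambda>k. m (k\<^sup>2) / real (k\<^sup>2)) \<longlonglongrightarrow> 0"
  shows "(\<lambda>T. m T / real T) \<longlonglongrightarrow> 0"
proof -
  have step: "\<bar>m (a + j) - m a\<bar> \<le> real j * C" for a j
  proof (induction j)
    case (Suc j)
    have "\<bar>m (a + Suc j) - m a\<bar> \<le> \<bar>m (Suc (a + j)) - m (a + j)\<bar> + \<bar>m (a + j) - m a\<bar>"
      by simp
    also have "\<dots> \<le> C + real j * C" using incr Suc by (intro add_mono)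
    finally show ?case by (simp add: algebra_simps)
  qed simp
  have C: "C \<ge> 0" using incr[of 0] by linarith
  have sqrt_top: "filterlim floor_sqrt at_top at_top"
    unfolding filterlim_at_top
  proof
    fix Z
    show "\<forall>\<^sub>F x in at_top. Z \<le> floor_sqrt x"
      using eventually_ge_at_top[of "Z\<^sup>2"] by eventually_elim (rule le_floor_sqrtI)
  qed
  let ?b = "\<lambda>k. \<bar>m (k\<^sup>2) / real (k\<^sup>2)\<bar> + 2 * C / real k"
  have "(\<lambda>k. 2 * C / real k) \<longlonglongrightarrow> 0"
    by (rule lim_const_over_n)
  then have "?b \<longlonglongrightarrow> 0"
    using tendsto_add[OF tendsto_rabs[OF sq]] by force
  then have b: "(\<lambda>T. ?b (floor_sqrt T)) \<longlonglongrightarrow> 0"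
    by (rule filterlim_compose[OF _ sqrt_top])
  show ?thesis
  proof (rule Lim_null_comparison[OF _ b])
    show "\<forall>\<^sub>F T in sequentially. norm (m T / real T) \<le> ?b (floor_sqrt T)"
      using eventually_ge_at_top[of 1]
    proof eventually_elim
      fix T :: nat assume T: "1 \<le> T"
      define k where "k = floor_sqrt T"
      have k: "k \<ge> 1" using T by (simp add: k_def Suc_le_eq)
      have le: "k\<^sup>2 \<le> T" by (simp add: k_def)
      have "T < (Suc k)\<^sup>2" unfolding k_def by (rule Suc_floor_sqrt_power2_gt)
      then have gap: "T - k\<^sup>2 \<le> 2 * k" by (simp add: power2_eq_square)
      have "\<bar>m T - m (k\<^sup>2)\<bar> \<le> real (T - k\<^sup>2) * C"
        using step[of "k\<^sup>2" "T - k\<^sup>2"] le by simp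
      also have "\<dots> \<le> real (2 * k) * C"
        using gap C by (intro mult_right_mono) linarith+
      finally have "\<bar>m T\<bar> \<le> \<bar>m (k\<^sup>2)\<bar> + 2 * k * C" by simp
      then have "\<bar>m T\<bar> / real T \<le> (\<bar>m (k\<^sup>2)\<bar> + 2 * k * C) / real T"
        by (rule divide_right_mono) simp
      also have "\<dots> \<le> (\<bar>m (k\<^sup>2)\<bar> + 2 * k * C) / real (k\<^sup>2)"
      proof (rule divide_left_mono)
        show "real (k\<^sup>2) \<le> real T" using le by (rule of_nat_mono)
        show "0 < real T * real (k\<^sup>2)" using k T by simp
      qed (use C in simp)
      also have "\<dots> = ?b k"
        using k by (simp add: field_simps power2_eq_square)
      finally show "norm (m T / real T) \<le> ?b (floor_sqrt T)" by (simp add: k_def)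
    qed
  qed
qed

context finite_chain
begin

text \<open>
  With \<open>D t\<close> the martingale increment \<open>H (\<omega> (t + 1)) - (K H) (\<omega> t)\<close>, the sum of the first \<open>T\<close> values
  of \<open>F - \<eta>\<close> is \<open>H (\<omega> 0) - H (\<omega> T)\<close> plus the sum \<open>M T\<close> of the increments. By the Markov property
  \<open>D T\<close> is orthogonal to \<open>M T\<close>, so the second moment of \<open>M T\<close> is at most \<open>T C\<^sup>2\<close>, and the
  normalised second moments along the squares are summable.
\<close>

lemma ergodic_theorem:
  fixes F H :: "'x \<Rightarrow> real"
  assumes \<nu>: "set_pmf \<nu> \<subseteq> S"
    and Poisson: "\<And>x. x \<in> S \<Longrightarrow> F x - \<eta> = H x - measure_pmf.expectation (K x) H"
  shows "AE \<omega> in markov_law \<nu> K. long_run_average (\<lambda>t. F (\<omega> t)) = \<eta>"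
proof -
  interpret prob_space "markov_law \<nu> K" by (rule prob_space_markov_law)
  let ?P = "\<lambda>x. measure_pmf.expectation (K x) H"
  define D where "D t \<omega> = H (\<omega> (Suc t)) - ?P (\<omega> t)" for t and \<omega> :: "nat \<Rightarrow> 'x"
  define M where "M T \<omega> = (\<Sum>t<T. D t \<omega>)" for T and \<omega> :: "nat \<Rightarrow> 'x"
  have D_meas [measurable]: "D t \<in> borel_measurable (markov_law \<nu> K)" for t
    unfolding D_def[abs_def] by measurable
  have M_meas [measurable]: "M T \<in> borel_measurable (markov_law \<nu> K)" for T
    unfolding M_def[abs_def] by measurable
  have D_dep: "D t \<omega> = D t x" if "\<And>k. k \<le> Suc t \<Longrightarrow> \<omega> k = x k" for t \<omega> x
    using that by (simp add: D_def)
  have M_dep: "M T \<omega> = M T x" if "\<And>k. k \<le> T \<Longrightarrow> \<omega> k = x k" for T \<omega> x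
    unfolding M_def by (intro sum.cong refl D_dep that) simp
  define B where "B = (\<Sum>x\<in>S. \<bar>H x\<bar>)"
  define C where "C = 2 * B"
  have H_bound: "\<bar>H x\<bar> \<le> B" if "x \<in> S" for x
    using member_le_sum[of x S "\<lambda>x. \<bar>H x\<bar>"] that finite_S by (simp add: B_def)
  have P_bound: "\<bar>?P x\<bar> \<le> B" if "x \<in> S" for x
  proof -
    have "\<bar>?P x\<bar> \<le> (\<Sum>y\<in>S. \<bar>pmf (K x) y * H y\<bar>)"
      unfolding expectation_eq_sum[OF closed[OF that]] by (rule sum_abs)
    also have "\<dots> \<le> B"
      unfolding B_def by (intro sum_mono) (simp add: abs_mult mult_left_le_one_le pmf_le_1)
    finally show ?thesis .
  qed
  have D_bound: "\<bar>D t \<omega>\<bar> \<le> C" if "\<forall>t. \<omega> t \<in> S" for t \<omega>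
    using H_bound[of "\<omega> (Suc t)"] P_bound[of "\<omega> t"] that by (auto simp: D_def C_def)
  have orth: "expectation (\<lambda>\<omega>. M T \<omega> * D T \<omega>) = 0" for T
  proof -
    have 1: "integrable (markov_law \<nu> K) (\<lambda>\<omega>. M T \<omega> * H (\<omega> (Suc T)))"
    proof (rule integrable_path[OF \<nu>, where t = "Suc T"])
      show "M T \<omega> * H (\<omega> (Suc T)) = M T x * H (x (Suc T))"
        if "\<And>k. k \<le> Suc T \<Longrightarrow> \<omega> k = x k" for \<omega> x
        using M_dep[of T \<omega> x] that by simp
    qed measurable
    have 2: "integrable (markov_law \<nu> K) (\<lambda>\<omega>. M T \<omega> * ?P (\<omega> T))"
    proof (rule integrable_path[OF \<nu>, where t = T])
      show "M T \<omega> * ?P (\<omega> T) = M T x * ?P (x T)" if "\<And>k. k \<le> T \<Longrightarrow> \<omega> k = x k" for \<omega> x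
        using M_dep[of T \<omega> x] that by simp
    qed measurable
    have "expectation (\<lambda>\<omega>. M T \<omega> * D T \<omega>) =
        expectation (\<lambda>\<omega>. M T \<omega> * H (\<omega> (Suc T))) - expectation (\<lambda>\<omega>. M T \<omega> * ?P (\<omega> T))"
      using 1 2 by (simp add: D_def right_diff_distrib)
    also have "\<dots> = 0"
      using Markov_property[OF \<nu> M_meas M_dep, where g = H] by simp
    finally show ?thesis .
  qed
  have second_moment: "expectation (\<lambda>\<omega>. (M T \<omega>)\<^sup>2) \<le> real T * C\<^sup>2" for T
  proof (induction T)
    case 0
    then show ?case by (simp add: M_def)
  next
    case (Suc T)
    have 1: "integrable (markov_law \<nu> K) (\<lambda>\<omega>. (M T \<omega>)\<^sup>2)"
    proof (rule integrable_path[OF \<nu>, where t = T])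
      show "(M T \<omega>)\<^sup>2 = (M T x)\<^sup>2" if "\<And>k. k \<le> T \<Longrightarrow> \<omega> k = x k" for \<omega> x
        using M_dep[of T \<omega> x] that by simp
    qed measurable
    have 2: "integrable (markov_law \<nu> K) (\<lambda>\<omega>. M T \<omega> * D T \<omega>)"
    proof (rule integrable_path[OF \<nu>, where t = "Suc T"])
      show "M T \<omega> * D T \<omega> = M T x * D T x" if "\<And>k. k \<le> Suc T \<Longrightarrow> \<omega> k = x k" for \<omega> x
        using M_dep[of T \<omega> x] D_dep[of T \<omega> x] that by simp
    qed measurable
    have 3: "integrable (markov_law \<nu> K) (\<lambda>\<omega>. (D T \<omega>)\<^sup>2)"
    proof (rule integrable_path[OF \<nu>, where t = "Suc T"])
      show "(D T \<omega>)\<^sup>2 = (D T x)\<^sup>2" if "\<And>k. k \<le> Suc T \<Longrightarrow> \<omega> k = x k" for \<omega> x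
        using D_dep[of T \<omega> x] that by simp
    qed measurable
    have "expectation (\<lambda>\<omega>. (D T \<omega>)\<^sup>2) \<le> expectation (\<lambda>\<omega>. C\<^sup>2)"
    proof (rule integral_mono_AE[OF 3])
      show "AE \<omega> in markov_law \<nu> K. (D T \<omega>)\<^sup>2 \<le> C\<^sup>2"
        using AE_in_S[OF \<nu>]
      proof eventually_elim
        fix \<omega> :: "nat \<Rightarrow> 'x" assume "\<forall>t. \<omega> t \<in> S"
        then show "(D T \<omega>)\<^sup>2 \<le> C\<^sup>2"
          using power_mono[OF D_bound, of \<omega> T 2] by simp
      qed
    qed simp
    then have D2: "expectation (\<lambda>\<omega>. (D T \<omega>)\<^sup>2) \<le> C\<^sup>2" by (simp add: prob_space)
    have "(\<lambda>\<omega>. (M (Suc T) \<omega>)\<^sup>2) = (\<lambda>\<omega>. (M T \<omega>)\<^sup>2 + 2 * (M T \<omega> * D T \<omega>) + (D T \<omega>)\<^sup>2)"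
      by (simp add: M_def power2_sum algebra_simps)
    then have "expectation (\<lambda>\<omega>. (M (Suc T) \<omega>)\<^sup>2) =
        expectation (\<lambda>\<omega>. (M T \<omega>)\<^sup>2) + 2 * expectation (\<lambda>\<omega>. M T \<omega> * D T \<omega>) +
        expectation (\<lambda>\<omega>. (D T \<omega>)\<^sup>2)"
      using 1 2 3 by simp
    also have "\<dots> \<le> real (Suc T) * C\<^sup>2"
      using Suc D2 orth by (simp add: algebra_simps)
    finally show ?case .
  qed
  have squares: "AE \<omega> in markov_law \<nu> K. (\<lambda>k. M (k\<^sup>2) \<omega> / real (k\<^sup>2)) \<longlonglongrightarrow> 0"
  proof -
    let ?Y = "\<lambda>k \<omega>. (M (k\<^sup>2) \<omega> / real (k\<^sup>2))\<^sup>2"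
    have int: "integrable (markov_law \<nu> K) (?Y k)" for k
    proof (rule integrable_path[OF \<nu>, where t = "k\<^sup>2"])
      show "?Y k \<omega> = ?Y k x" if "\<And>j. j \<le> k\<^sup>2 \<Longrightarrow> \<omega> j = x j" for \<omega> x
        using M_dep[of "k\<^sup>2" \<omega> x] that by simp
    qed measurable
    have "(\<integral>\<^sup>+\<omega>. ennreal (?Y k \<omega>) \<partial>markov_law \<nu> K) \<le> ennreal (C\<^sup>2 * (1 / real k ^ 2))" for k
    proof -
      have "expectation (?Y k) = expectation (\<lambda>\<omega>. (M (k\<^sup>2) \<omega>)\<^sup>2) / (real (k\<^sup>2))\<^sup>2"
        by (simp add: power_divide)
      also have "\<dots> \<le> real (k\<^sup>2) * C\<^sup>2 / (real (k\<^sup>2))\<^sup>2"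
        by (intro divide_right_mono second_moment) simp
      also have "\<dots> = C\<^sup>2 * (1 / real k ^ 2)"
        by (simp add: power2_eq_square)
      finally show ?thesis
        using int by (subst nn_integral_eq_integral) (auto intro: ennreal_leI)
    qed
    then have "(\<Sum>k. \<integral>\<^sup>+\<omega>. ennreal (?Y k \<omega>) \<partial>markov_law \<nu> K) \<le>
        (\<Sum>k. ennreal (C\<^sup>2 * (1 / real k ^ 2)))"
      by (intro suminf_le) auto
    also have "\<dots> < \<infinity>"
    proof -
      have "summable (\<lambda>k. C\<^sup>2 * (1 / real k ^ 2))"
        using inverse_power_summable[of 2, where ?'a = real]
        by (intro summable_mult) (simp add: inverse_eq_divide)
      then have "(\<Sum>k. ennreal (C\<^sup>2 * (1 / real k ^ 2))) \<noteq> top"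
        by (intro ennreal_suminf_neq_top) auto
      then show ?thesis by (simp add: less_top)
    qed
    finally have "(\<integral>\<^sup>+\<omega>. (\<Sum>k. ennreal (?Y k \<omega>)) \<partial>markov_law \<nu> K) < \<infinity>"
      by (subst nn_integral_suminf) auto
    then have "AE \<omega> in markov_law \<nu> K. (\<Sum>k. ennreal (?Y k \<omega>)) \<noteq> \<infinity>"
      by (intro nn_integral_noteq_infinite) auto
    then show ?thesis
    proof eventually_elim
      fix \<omega> assume "(\<Sum>k. ennreal (?Y k \<omega>)) \<noteq> \<infinity>"
      then have "summable (\<lambda>k. ?Y k \<omega>)"
        by (intro summable_suminf_not_top) auto
      then have "(\<lambda>k. ?Y k \<omega>) \<longlonglongrightarrow> 0" by (rule summable_LIMSEQ_zero)
      then have "(\<lambda>k. sqrt (?Y k \<omega>)) \<longlonglongrightarrow> sqrt 0" by (rule tendsto_real_sqrt)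
      then show "(\<lambda>k. M (k\<^sup>2) \<omega> / real (k\<^sup>2)) \<longlonglongrightarrow> 0"
        unfolding real_sqrt_abs real_sqrt_zero by (rule tendsto_rabs_zero_cancel)
    qed
  qed
  show ?thesis
    using squares AE_in_S[OF \<nu>]
  proof eventually_elim
    fix \<omega> :: "nat \<Rightarrow> 'x"
    assume sq: "(\<lambda>k. M (k\<^sup>2) \<omega> / real (k\<^sup>2)) \<longlonglongrightarrow> 0" and \<omega>: "\<forall>t. \<omega> t \<in> S"
    have "(\<lambda>T. M T \<omega> / real T) \<longlonglongrightarrow> 0"
      by (rule tendsto_average_from_squares[OF _ sq, of C]) (use D_bound[OF \<omega>] in \<open>simp add: M_def\<close>)
    moreover have "(\<lambda>T. (H (\<omega> 0) - H (\<omega> T)) / real T) \<longlonglongrightarrow> 0"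
    proof (rule Lim_null_comparison)
      show "(\<lambda>T. C / real T) \<longlonglongrightarrow> 0" by (rule lim_const_over_n)
      have "\<bar>H (\<omega> 0) - H (\<omega> T)\<bar> \<le> C" for T
        using H_bound[of "\<omega> 0"] H_bound[of "\<omega> T"] \<omega> by (auto simp: C_def)
      then show "\<forall>\<^sub>F T in sequentially. norm ((H (\<omega> 0) - H (\<omega> T)) / real T) \<le> C / real T"
        by (intro always_eventually allI) (simp add: divide_right_mono)
    qed
    ultimately have "(\<lambda>T. M T \<omega> / real T + (H (\<omega> 0) - H (\<omega> T)) / real T) \<longlonglongrightarrow> 0"
      by (rule tendsto_add_zero)
    from tendsto_add[OF tendsto_const[of \<eta>] this]
    have lim: "(\<lambda>T. \<eta> + (M T \<omega> / real T + (H (\<omega> 0) - H (\<omega> T)) / real T)) \<longlonglongrightarrow> \<eta>"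
      by simp
    have tele: "(\<Sum>t<T. F (\<omega> t)) = real T * \<eta> + M T \<omega> + (H (\<omega> 0) - H (\<omega> T))" for T
    proof (induction T)
      case (Suc T)
      have "F (\<omega> T) = \<eta> + (H (\<omega> T) - ?P (\<omega> T))"
        using Poisson[of "\<omega> T"] \<omega> by simp
      then show ?case
        unfolding sum.lessThan_Suc Suc M_def D_def by (simp add: algebra_simps)
    qed (simp add: M_def)
    have "(\<lambda>T. 1 / real T * (\<Sum>t<T. F (\<omega> t))) \<longlonglongrightarrow> \<eta>"
    proof (rule Lim_transform_eventually[OF lim])
      show "\<forall>\<^sub>F T in sequentially. \<eta> + (M T \<omega> / real T + (H (\<omega> 0) - H (\<omega> T)) / real T) =
          1 / real T * (\<Sum>t<T. F (\<omega> t))"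
        using eventually_gt_at_top[of 0]
      proof eventually_elim
        fix T :: nat assume "0 < T"
        then show "\<eta> + (M T \<omega> / real T + (H (\<omega> 0) - H (\<omega> T)) / real T) =
            1 / real T * (\<Sum>t<T. F (\<omega> t))"
          unfolding tele by (simp add: add_divide_distrib diff_divide_distrib)
      qed
    qed
    then show "long_run_average (\<lambda>t. F (\<omega> t)) = \<eta>"
      unfolding long_run_average_def by (rule limI)
  qed
qed

end


section \<open>Geometric ergodicity and the Poisson equation\<close>

text \<open>
  The differences of elements of the semigroup (with \<open>0\<close> added) contain their own gcd by Bezout,
  hence \<open>1\<close>. So the semigroup contains two consecutive numbers \<open>a\<close> and \<open>a + 1\<close>. If \<open>a > 0\<close>, every \<open>m \<ge> a\<^sup>2\<close> is
  \<open>(q - k) a + k (a + 1)\<close> with \<open>q\<close> the quotient and \<open>k\<close> the remainder of \<open>m\<close> by \<open>a\<close>.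
\<close>

lemma numerical_semigroup_cofinite:
  fixes A :: "nat set"
  assumes add: "\<And>a b. a \<in> A \<Longrightarrow> b \<in> A \<Longrightarrow> a + b \<in> A" and gcd: "Gcd A = 1"
  shows "\<forall>\<^sub>F m in sequentially. m \<in> A"
proof -
  have A0: "a + b \<in> insert 0 A" if "a \<in> insert 0 A" "b \<in> insert 0 A" for a b
    using that add by auto
  have mult: "j * a \<in> insert 0 A" if "a \<in> insert 0 A" for j a
    by (induction j) (use that A0 in auto)
  define D where "D = {d. \<exists>a\<in>insert 0 A. a + d \<in> insert 0 A}"
  have D_mult: "j * d \<in> D" if "d \<in> D" for j d
  proof -
    obtain a where a: "a \<in> insert 0 A" "a + d \<in> insert 0 A"
      using \<open>d \<in> D\<close> unfolding D_def by blast
    have "j * a \<in> insert 0 A" "j * a + j * d \<in> insert 0 A"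
      using mult[OF a(1)] mult[OF a(2), of j] by (simp_all add: distrib_left)
    then show ?thesis unfolding D_def by blast
  qed
  have D_diff: "d \<in> D" if "e + d \<in> D" "e \<in> D" for d e
  proof -
    obtain a b where a: "a \<in> insert 0 A" "a + (e + d) \<in> insert 0 A"
      and b: "b \<in> insert 0 A" "b + e \<in> insert 0 A"
      using \<open>e + d \<in> D\<close> \<open>e \<in> D\<close> unfolding D_def by blast
    have "(a + (b + e)) + d = (a + (e + d)) + b" by simp
    with A0[OF a(1) b(2)] A0[OF a(2) b(1)] show ?thesis unfolding D_def
      by (metis (mono_tags, lifting) mem_Collect_eq)
  qed
  have "Gcd D \<in> D"
  proof (rule Gcd_in)
    show "gcd d e \<in> D" if "d \<in> D" "e \<in> D" for d e
    proof (cases "d = 0")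
      case False
      then obtain x y where xy: "d * x = e * y + gcd d e" using bezout_nat by blast
      show ?thesis
      proof (rule D_diff)
        show "y * e + gcd d e \<in> D"
          using D_mult[OF \<open>d \<in> D\<close>, of x] by (simp only: xy mult.commute[of x] mult.commute[of y])
        show "y * e \<in> D" using \<open>e \<in> D\<close> by (rule D_mult)
      qed
    qed (use that in simp)
    show "D \<noteq> {}" by (auto simp: D_def)
  qed
  moreover have "Gcd D dvd Gcd A"
    by (intro Gcd_greatest Gcd_dvd) (auto simp: D_def)
  ultimately have "1 \<in> D" using gcd by simp
  then obtain a where a: "a \<in> insert 0 A" "a + 1 \<in> insert 0 A"
    unfolding D_def by blast
  show ?thesis
  proof (cases "a = 0")
    case True
    then have "1 \<in> A" using a by simp
    then have "m \<in> insert 0 A" for m using mult[of 1 m] by simp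
    then have "m \<in> A" if "m > 0" for m using that by (metis insertE less_irrefl)
    then show ?thesis using eventually_gt_at_top[of 0] by (rule eventually_mono[rotated])
  next
    case False
    show ?thesis using eventually_ge_at_top[of "a * a"]
    proof eventually_elim
      fix m assume m: "a * a \<le> m"
      have "a \<le> m div a" using False m by (simp add: less_eq_div_iff_mult_less_eq)
      moreover have "m mod a < a" using False by simp
      ultimately have le: "m mod a \<le> m div a" by simp
      have "m = (m div a - m mod a) * a + m mod a * (a + 1)"
        using le by (simp add: algebra_simps diff_mult_distrib)
      moreover have "(m div a - m mod a) * a + m mod a * (a + 1) \<in> insert 0 A"
        by (intro A0 mult a)
      ultimately have "m \<in> insert 0 A" by simp
      moreover have "0 < a * a" using False by simp
      then have "m \<noteq> 0" using m by linarith
      ultimately show "m \<in> A" by simp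
    qed
  qed
qed

lemma nstep_add: "nstep K (s + t) x = bind_pmf (nstep K s x) (nstep K t)"
  by (induction t) (simp_all add: bind_return_pmf' bind_assoc_pmf)

lemma pmf_nstep_pos_add:
  assumes "pmf (nstep K s x) y > 0" "pmf (nstep K t y) z > 0"
  shows "pmf (nstep K (s + t) x) z > 0"
  using assms unfolding nstep_add pmf_positive_iff by auto

context finite_chain
begin

text \<open>
  The return times to a state form a semigroup with gcd \<open>1\<close>, so a return is possible at all large
  times; composing with a path between two states makes that transition possible at all large times.
\<close>

lemma ergodic_primitive:
  assumes erg: "ergodic_chain S K"
  shows "\<exists>N>0. \<forall>x\<in>S. \<forall>y\<in>S. pmf (nstep K N x) y > 0"
proof -
  have "\<forall>\<^sub>F m in sequentially. pmf (nstep K m x) y > 0" if x: "x \<in> S" and y: "y \<in> S" for x y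
  proof -
    let ?R = "{t. t > 0 \<and> pmf (nstep K t y) y > 0}"
    have "\<forall>\<^sub>F m in sequentially. m \<in> ?R"
    proof (rule numerical_semigroup_cofinite)
      show "Gcd ?R = 1" using erg y by (auto simp: ergodic_chain_def aperiodic_chain_def)
    qed (auto intro: pmf_nstep_pos_add)
    moreover obtain t where t: "pmf (nstep K t x) y > 0"
      using erg x y by (auto simp: ergodic_chain_def irreducible_chain_def)
    ultimately have "\<forall>\<^sub>F m in sequentially. pmf (nstep K (t + m) x) y > 0"
      by (auto elim!: eventually_mono intro: pmf_nstep_pos_add)
    then show ?thesis
      using eventually_sequentially_seg[of "\<lambda>m. pmf (nstep K m x) y > 0" t]
      by (simp add: add.commute)
  qed
  then have "\<forall>\<^sub>F m in sequentially. m > 0 \<and> (\<forall>x\<in>S. \<forall>y\<in>S. pmf (nstep K m x) y > 0)"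
    by (intro eventually_conj eventually_gt_at_top eventually_ball_finite ballI finite_S)
  then show ?thesis
    unfolding eventually_sequentially by blast
qed

abbreviation trans_op :: "nat \<Rightarrow> ('x \<Rightarrow> real) \<Rightarrow> 'x \<Rightarrow> real" where
  "trans_op t f x \<equiv> measure_pmf.expectation (nstep K t x) f"

lemma trans_op_add: "x \<in> S \<Longrightarrow> trans_op (s + t) f x = trans_op s (trans_op t f) x"
  unfolding nstep_add by (intro expectation_bind set_nstep)

text \<open>
  Both distributions contain \<open>\<delta>\<close> times the counting measure on \<open>S\<close>. This common part cancels in the
  difference of the expectations, and the remaining mass is \<open>1 - \<delta> card S\<close>. With \<open>\<delta> = 0\<close> the lemma says that
  averaging does not increase the oscillation.
\<close>

lemma Doeblin_contraction:
  fixes f :: "'x \<Rightarrow> real"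
  assumes p: "set_pmf p \<subseteq> S" "set_pmf p' \<subseteq> S"
    and \<delta>: "\<And>z. z \<in> S \<Longrightarrow> \<delta> \<le> pmf p z" "\<And>z. z \<in> S \<Longrightarrow> \<delta> \<le> pmf p' z"
    and osc: "\<And>x y. x \<in> S \<Longrightarrow> y \<in> S \<Longrightarrow> f x - f y \<le> d"
  shows "measure_pmf.expectation p f - measure_pmf.expectation p' f \<le> (1 - \<delta> * card S) * d"
proof -
  have "S \<noteq> {}" using p set_pmf_not_empty by fastforce
  then obtain m where m: "m \<in> S" "\<And>x. x \<in> S \<Longrightarrow> f m \<le> f x"
    using finite_S by (metis arg_min_if_finite(1) arg_min_least)
  have eq: "measure_pmf.expectation q f =
      f m + \<delta> * (\<Sum>z\<in>S. f z - f m) + (\<Sum>z\<in>S. (pmf q z - \<delta>) * (f z - f m))" if "set_pmf q \<subseteq> S" for q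
  proof -
    have "(\<Sum>z\<in>S. (pmf q z - \<delta>) * (f z - f m)) =
        (\<Sum>z\<in>S. pmf q z * f z) - (\<Sum>z\<in>S. pmf q z) * f m - \<delta> * (\<Sum>z\<in>S. f z - f m)"
      by (simp add: algebra_simps sum.distrib sum_subtractf sum_distrib_left sum_distrib_right)
    then show ?thesis
      by (simp add: expectation_eq_sum[OF that] sum_pmf_eq_1[OF finite_S that])
  qed
  have "(\<Sum>z\<in>S. (pmf p z - \<delta>) * (f z - f m)) \<le> (\<Sum>z\<in>S. (pmf p z - \<delta>) * d)"
    using \<delta> osc m by (intro sum_mono mult_left_mono) auto
  also have "\<dots> = (1 - \<delta> * card S) * d"
    by (simp add: sum_pmf_eq_1[OF finite_S p(1)] sum_subtractf mult.commute[of \<delta>]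
        flip: sum_distrib_right)
  finally have "(\<Sum>z\<in>S. (pmf p z - \<delta>) * (f z - f m)) \<le> (1 - \<delta> * card S) * d" .
  moreover have "0 \<le> (\<Sum>z\<in>S. (pmf p' z - \<delta>) * (f z - f m))"
    using \<delta> m by (intro sum_nonneg mult_nonneg_nonneg) auto
  ultimately show ?thesis
    using eq[OF p(1)] eq[OF p(2)] by linarith
qed

text \<open>
  Some power \<open>N\<close> of the kernel has positive entries only, so \<open>N\<close> steps shrink every oscillation by a factor
  \<open>c < 1\<close>. The rate per step is the \<open>N\<close>-th root of \<open>c\<close>, and the constant \<open>1 / c\<close> absorbs an
  incomplete last block.
\<close>

lemma geometric_contraction:
  assumes erg: "ergodic_chain S K" and ne: "S \<noteq> {}"
  obtains \<rho> C where "0 \<le> \<rho>" "\<rho> < 1" "0 \<le> C"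
    and "\<And>f d t x y. (\<And>x y. x \<in> S \<Longrightarrow> y \<in> S \<Longrightarrow> f x - f y \<le> d) \<Longrightarrow> x \<in> S \<Longrightarrow> y \<in> S \<Longrightarrow>
      trans_op t f x - trans_op t f y \<le> C * \<rho> ^ t * d"
proof -
  obtain N where N: "N > 0" and pos: "\<And>x y. x \<in> S \<Longrightarrow> y \<in> S \<Longrightarrow> pmf (nstep K N x) y > 0"
    using ergodic_primitive[OF erg] by blast
  define \<delta> where "\<delta> = Min ((\<lambda>(x, y). pmf (nstep K N x) y) ` (S \<times> S))"
  have \<delta>_le: "\<delta> \<le> pmf (nstep K N x) y" if "x \<in> S" "y \<in> S" for x y
    unfolding \<delta>_def using that finite_S by (intro Min_le) auto
  have \<delta>_pos: "\<delta> > 0"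
    unfolding \<delta>_def using pos ne finite_S by (subst Min_gr_iff) auto
  \<comment> \<open>Without the factor \<open>1/2\<close>, \<open>c\<close> would vanish for uniform rows and \<open>1 / c\<close> would be lost.\<close>
  define c where "c = 1 - \<delta> / 2 * card S"
  have card: "real (card S) > 0" using ne finite_S by (simp add: card_gt_0_iff)
  have "\<delta> * card S \<le> 1"
  proof -
    obtain x where x: "x \<in> S" using ne by blast
    have "(\<Sum>y\<in>S. \<delta>) \<le> (\<Sum>y\<in>S. pmf (nstep K N x) y)"
      using \<delta>_le x by (intro sum_mono)
    then show ?thesis
      using sum_pmf_eq_1[OF finite_S set_nstep[OF x]] by (simp add: mult.commute)
  qed
  then have c: "c > 0" "c < 1" using card \<delta>_pos by (simp_all add: c_def)
  define \<rho> where "\<rho> = root N c"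
  have \<rho>: "0 < \<rho>" "\<rho> < 1" using c N by (simp_all add: \<rho>_def)
  have \<rho>N: "\<rho> ^ N = c" using c N by (simp add: \<rho>_def)
  have osc0: "trans_op t f x - trans_op t f y \<le> d"
    if "\<And>x y. x \<in> S \<Longrightarrow> y \<in> S \<Longrightarrow> f x - f y \<le> d" "x \<in> S" "y \<in> S" for f d t x y
    using Doeblin_contraction[OF set_nstep set_nstep, of x y 0 t t f d] that by simp
  have oscN: "trans_op (k * N) f x - trans_op (k * N) f y \<le> c ^ k * d"
    if "\<And>x y. x \<in> S \<Longrightarrow> y \<in> S \<Longrightarrow> f x - f y \<le> d" "x \<in> S" "y \<in> S" for f d k x y
    using that(2,3)
  proof (induction k arbitrary: x y)
    case 0
    then show ?case using that(1) by simp
  next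
    case (Suc k)
    have "trans_op N (trans_op (k * N) f) x - trans_op N (trans_op (k * N) f) y \<le> c * (c ^ k * d)"
      unfolding c_def
    proof (rule Doeblin_contraction)
      show "\<delta> / 2 \<le> pmf (nstep K N x) z" "\<delta> / 2 \<le> pmf (nstep K N y) z" if "z \<in> S" for z
        using \<delta>_le[of x z] \<delta>_le[of y z] \<delta>_pos that Suc.prems by simp_all
    qed (use Suc set_nstep in \<open>auto simp: c_def\<close>)
    then show ?case
      using Suc.prems by (simp add: trans_op_add)
  qed
  show thesis
  proof (rule that)
    show "0 \<le> \<rho>" "\<rho> < 1" "0 \<le> 1 / c" using \<rho> c by simp_all
    fix f :: "'x \<Rightarrow> real" and d t x y
    assume osc: "\<And>x y. x \<in> S \<Longrightarrow> y \<in> S \<Longrightarrow> f x - f y \<le> d" and x: "x \<in> S" "y \<in> S"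
    have d: "d \<ge> 0" using osc[OF x(1) x(1)] by simp
    let ?k = "t div N" and ?j = "t mod N"
    have t: "t = ?k * N + ?j" by simp
    have "trans_op t f x - trans_op t f y \<le> c ^ ?k * d"
    proof -
      have "trans_op t f z = trans_op (?k * N) (trans_op ?j f) z" if "z \<in> S" for z
        using trans_op_add[OF that, of "?k * N" ?j f] t by simp
      then show ?thesis
        using oscN[of "trans_op ?j f" d x y ?k] osc0[OF osc] x by simp
    qed
    also have "c ^ ?k \<le> 1 / c * \<rho> ^ t"
    proof -
      have "t \<le> ?k * N + N" using t mod_less_divisor[OF N, of t] by linarith
      then have "\<rho> ^ (?k * N + N) \<le> \<rho> ^ t" using \<rho> by (intro power_decreasing) auto
      moreover have "\<rho> ^ (?k * N + N) = c ^ ?k * c"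
        by (simp add: power_add \<rho>N mult.commute[of ?k] power_mult)
      ultimately show ?thesis using c by (simp add: field_simps)
    qed
    finally show "trans_op t f x - trans_op t f y \<le> 1 / c * \<rho> ^ t * d"
      using d by (simp add: mult_right_mono)
  qed
qed

definition stationary :: "'x pmf \<Rightarrow> bool" where
  "stationary \<pi> \<longleftrightarrow> set_pmf \<pi> \<subseteq> S \<and> (\<forall>y\<in>S. (\<Sum>x\<in>S. pmf \<pi> x * pmf (K x) y) = pmf \<pi> y)"

lemma stationary_bind:
  assumes "stationary \<pi>"
  shows "bind_pmf \<pi> K = \<pi>"
proof (rule pmf_eqI)
  fix y
  have \<pi>: "set_pmf \<pi> \<subseteq> S" using assms by (simp add: stationary_def)
  have "pmf (bind_pmf \<pi> K) y = (\<Sum>x\<in>S. pmf \<pi> x * pmf (K x) y)"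
    by (simp add: pmf_bind expectation_eq_sum[OF \<pi>])
  also have "\<dots> = pmf \<pi> y"
  proof (cases "y \<in> S")
    case True
    then show ?thesis using assms by (simp add: stationary_def)
  next
    case False
    then have "pmf (K x) y = 0" if "x \<in> S" for x
      using closed[OF that] by (auto simp: pmf_eq_0_set_pmf)
    moreover have "pmf \<pi> y = 0" using False \<pi> by (auto simp: pmf_eq_0_set_pmf)
    ultimately show ?thesis by simp
  qed
  finally show "pmf (bind_pmf \<pi> K) y = pmf \<pi> y" .
qed

lemma stationary_trans_op:
  fixes f :: "'x \<Rightarrow> real"
  assumes "stationary \<pi>"
  shows "measure_pmf.expectation \<pi> (trans_op t f) = measure_pmf.expectation \<pi> f"
proof -
  have \<pi>: "set_pmf \<pi> \<subseteq> S" using assms by (simp add: stationary_def)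
  have inv: "bind_pmf \<pi> (nstep K t) = \<pi>"
  proof (induction t)
    case (Suc t)
    have "bind_pmf \<pi> (nstep K (Suc t)) = bind_pmf (bind_pmf \<pi> (nstep K t)) K"
      unfolding bind_assoc_pmf nstep.simps(2)[abs_def] ..
    then show ?case unfolding Suc stationary_bind[OF assms] .
  qed (simp add: nstep.simps(1)[abs_def] bind_return_pmf')
  have "measure_pmf.expectation (bind_pmf \<pi> (nstep K t)) f = measure_pmf.expectation \<pi> (trans_op t f)"
    by (intro expectation_bind \<pi> set_nstep)
  then show ?thesis unfolding inv ..
qed

lemma osc_bound: "x \<in> S \<Longrightarrow> y \<in> S \<Longrightarrow> f x - f y \<le> 2 * (\<Sum>z\<in>S. \<bar>f z\<bar>)" for f :: "'x \<Rightarrow> real"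
  using member_le_sum[of x S "\<lambda>z. \<bar>f z\<bar>"] member_le_sum[of y S "\<lambda>z. \<bar>f z\<bar>"] finite_S by auto

lemma expectation_diff_le:
  fixes f :: "'x \<Rightarrow> real"
  assumes "set_pmf p \<subseteq> S" "set_pmf p' \<subseteq> S" "\<And>x y. x \<in> S \<Longrightarrow> y \<in> S \<Longrightarrow> f x - f y \<le> d"
  shows "\<bar>measure_pmf.expectation p f - measure_pmf.expectation p' f\<bar> \<le> d"
  using Doeblin_contraction[of p p' 0 f d] Doeblin_contraction[of p' p 0 f d] assms by auto

text \<open>
  Only the summability of the bound matters later: it makes transition probabilities converge and the
  series of the potential converge absolutely.
\<close>

lemma geometric_convergence:
  fixes f :: "'x \<Rightarrow> real"
  assumes erg: "ergodic_chain S K" and ne: "S \<noteq> {}"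
  shows "\<exists>b. summable b \<and> (\<forall>t p p'. set_pmf p \<subseteq> S \<longrightarrow> set_pmf p' \<subseteq> S \<longrightarrow>
      \<bar>measure_pmf.expectation p (trans_op t f) - measure_pmf.expectation p' (trans_op t f)\<bar> \<le> b t)"
proof -
  obtain \<rho> C where \<rho>: "0 \<le> \<rho>" "\<rho> < 1" "0 \<le> C"
    and contr: "\<And>f d t x y. (\<And>x y. x \<in> S \<Longrightarrow> y \<in> S \<Longrightarrow> f x - f y \<le> d) \<Longrightarrow> x \<in> S \<Longrightarrow> y \<in> S \<Longrightarrow>
      trans_op t f x - trans_op t f y \<le> C * \<rho> ^ t * d"
    using geometric_contraction[OF erg ne] by blast
  let ?d = "2 * (\<Sum>z\<in>S. \<bar>f z\<bar>)"
  have "summable (\<lambda>t. C * \<rho> ^ t * ?d)"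
    using \<rho> by (intro summable_mult summable_mult2 summable_geometric) simp
  moreover have "\<bar>measure_pmf.expectation p (trans_op t f) - measure_pmf.expectation p' (trans_op t f)\<bar>
      \<le> C * \<rho> ^ t * ?d" if "set_pmf p \<subseteq> S" "set_pmf p' \<subseteq> S" for t p p'
    by (intro expectation_diff_le that contr osc_bound)
  ultimately show ?thesis by blast
qed

text \<open>
  The stationary distribution is the limit of the law of the chain started in a fixed state. The
  law at time \<open>t + 1\<close> is that at time \<open>t\<close> for the initial law \<open>K x0\<close>, so consecutive laws differ by a summable
  amount.
\<close>

lemma ex_stationary:
  assumes erg: "ergodic_chain S K" and ne: "S \<noteq> {}"
  shows "\<exists>\<pi>. stationary \<pi>"
proof -
  obtain x0 where x0: "x0 \<in> S" using ne by blast
  have "\<exists>l. (\<lambda>t. pmf (nstep K t x0) y) \<longlonglongrightarrow> l" for y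
  proof -
    let ?f = "indicator {y} :: 'x \<Rightarrow> real"
    have pmf: "pmf p y = measure_pmf.expectation p ?f" for p
      by (simp add: measure_pmf_single)
    obtain b where b: "summable b" and bound: "\<And>t p p'. set_pmf p \<subseteq> S \<Longrightarrow> set_pmf p' \<subseteq> S \<Longrightarrow>
      \<bar>measure_pmf.expectation p (trans_op t ?f) - measure_pmf.expectation p' (trans_op t ?f)\<bar> \<le> b t"
      using geometric_convergence[OF erg ne, of ?f] by blast
    have "summable (\<lambda>t. pmf (nstep K (Suc t) x0) y - pmf (nstep K t x0) y)"
    proof (rule summable_comparison_test'[OF b])
      fix t :: nat
      have "pmf (nstep K (Suc t) x0) y = measure_pmf.expectation (nstep K 1 x0) (trans_op t ?f)"
        using trans_op_add[OF x0, of 1 t ?f] by (simp only: pmf plus_1_eq_Suc)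
      moreover have "pmf (nstep K t x0) y = measure_pmf.expectation (return_pmf x0) (trans_op t ?f)"
        by (simp only: pmf) simp
      ultimately show "norm (pmf (nstep K (Suc t) x0) y - pmf (nstep K t x0) y) \<le> b t"
        using bound[OF set_nstep[OF x0, of 1], of "return_pmf x0" t] x0 by simp
    qed
    then have "convergent (\<lambda>T. \<Sum>t<T. pmf (nstep K (Suc t) x0) y - pmf (nstep K t x0) y)"
      by (simp add: summable_iff_convergent)
    then have "convergent (\<lambda>T. pmf (nstep K T x0) y - pmf (nstep K 0 x0) y)"
      by (simp only: sum_lessThan_telescope[of "\<lambda>t. pmf (nstep K t x0) y"])
    then have "convergent (\<lambda>T. pmf (nstep K T x0) y)"
      by (simp only: convergent_diff_const_right_iff)
    then show ?thesis by (simp add: convergent_def)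
  qed
  then obtain l where l: "\<And>y. (\<lambda>t. pmf (nstep K t x0) y) \<longlonglongrightarrow> l y" by metis
  have l_nonneg: "l y \<ge> 0" for y
    by (rule LIMSEQ_le_const[OF l]) simp
  have l_out: "l y = 0" if "y \<notin> S" for y
  proof -
    have "pmf (nstep K t x0) y = 0" for t
      using set_nstep[OF x0, of t] that by (auto simp: pmf_eq_0_set_pmf)
    then show ?thesis using LIMSEQ_unique[OF l[of y]] by simp
  qed
  have l_sum: "(\<Sum>y\<in>S. l y) = 1"
  proof -
    have "(\<lambda>t. \<Sum>y\<in>S. pmf (nstep K t x0) y) \<longlonglongrightarrow> (\<Sum>y\<in>S. l y)"
      by (intro tendsto_sum l)
    then show ?thesis
      using sum_pmf_eq_1[OF finite_S set_nstep[OF x0]] by (simp add: LIMSEQ_const_iff)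
  qed
  define \<pi> where "\<pi> = embed_pmf l"
  have "(\<integral>\<^sup>+y. ennreal (l y) \<partial>count_space UNIV) = (\<integral>\<^sup>+y. ennreal (l y) \<partial>count_space S)"
    by (rule nn_integral_count_space_eq) (auto simp: l_out)
  also have "\<dots> = 1"
    using finite_S l_nonneg l_sum by (simp add: nn_integral_count_space_finite sum_ennreal)
  finally have pmf_\<pi>: "pmf \<pi> y = l y" for y
    unfolding \<pi>_def using l_nonneg by (intro pmf_embed_pmf) auto
  have "stationary \<pi>"
    unfolding stationary_def
  proof (intro conjI ballI)
    show "set_pmf \<pi> \<subseteq> S"
      using l_out by (auto simp: set_pmf_eq pmf_\<pi>)
    fix y assume "y \<in> S"
    have "(\<lambda>t. \<Sum>x\<in>S. pmf (nstep K t x0) x * pmf (K x) y) \<longlonglongrightarrow> (\<Sum>x\<in>S. l x * pmf (K x) y)"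
      by (intro tendsto_intros l)
    moreover have "(\<Sum>x\<in>S. pmf (nstep K t x0) x * pmf (K x) y) = pmf (nstep K (Suc t) x0) y" for t
      by (simp add: pmf_bind expectation_eq_sum[OF set_nstep[OF x0]])
    ultimately have "(\<lambda>t. pmf (nstep K (Suc t) x0) y) \<longlonglongrightarrow> (\<Sum>x\<in>S. l x * pmf (K x) y)"
      by simp
    then show "(\<Sum>x\<in>S. pmf \<pi> x * pmf (K x) y) = pmf \<pi> y"
      unfolding pmf_\<pi> using LIMSEQ_unique LIMSEQ_Suc[OF l] by blast
  qed
  then show ?thesis ..
qed

lemma stationary_limit:
  fixes f :: "'x \<Rightarrow> real"
  assumes "ergodic_chain S K" and \<pi>: "stationary \<pi>" and p: "set_pmf p \<subseteq> S"
  shows "(\<lambda>t. measure_pmf.expectation p (trans_op t f)) \<longlonglongrightarrow> measure_pmf.expectation \<pi> f"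
proof -
  have "S \<noteq> {}" using p set_pmf_not_empty by fastforce
  then obtain b where b: "summable b" and bound: "\<And>t p p'. set_pmf p \<subseteq> S \<Longrightarrow> set_pmf p' \<subseteq> S \<Longrightarrow>
      \<bar>measure_pmf.expectation p (trans_op t f) - measure_pmf.expectation p' (trans_op t f)\<bar> \<le> b t"
    using geometric_convergence[OF assms(1), of f] by blast
  have "(\<lambda>t. measure_pmf.expectation p (trans_op t f) - measure_pmf.expectation \<pi> f) \<longlonglongrightarrow> 0"
    by (rule Lim_null_comparison[OF _ summable_LIMSEQ_zero[OF b]])
      (use bound[OF p, of \<pi>] \<pi> in \<open>simp add: stationary_trans_op[OF \<pi>] stationary_def\<close>)
  then show ?thesis by (rule LIM_zero_cancel)
qed

lemma stationary_stationary_dist: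
  assumes erg: "ergodic_chain S K" and ne: "S \<noteq> {}"
  shows "stationary (stationary_dist S K)"
proof -
  obtain \<pi> where \<pi>: "stationary \<pi>" using ex_stationary[OF assms] ..
  have "\<pi>' = \<pi>" if \<pi>': "stationary \<pi>'" for \<pi>'
  proof (rule pmf_eqI)
    fix y
    obtain x where "x \<in> S" using ne by blast
    then have x: "set_pmf (return_pmf x) \<subseteq> S" by simp
    have "measure_pmf.expectation \<pi>' (indicator {y}) = measure_pmf.expectation \<pi> (indicator {y} :: _ \<Rightarrow> real)"
      by (rule LIMSEQ_unique[OF stationary_limit[OF erg \<pi>' x] stationary_limit[OF erg \<pi> x]])
    then show "pmf \<pi>' y = pmf \<pi> y" by (simp add: measure_pmf_single)
  qed
  then have "\<exists>!\<pi>. stationary \<pi>" using \<pi> by blast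
  then show ?thesis
    using theI'[of stationary] by (simp add: stationary_dist_def stationary_def[abs_def])
qed

text \<open>
  The solution is \<open>h = \<Sum>\<^sub>t (P\<^sup>t f - \<eta>)\<close>: applying the kernel shifts the series by one term.
  The first conclusion is what identifies \<open>h\<close> with the potential.
\<close>

lemma Poisson_solution:
  fixes f :: "'x \<Rightarrow> real"
  assumes erg: "ergodic_chain S K" and ne: "S \<noteq> {}"
  defines "\<eta> \<equiv> measure_pmf.expectation (stationary_dist S K) f"
  obtains h where "\<And>x. x \<in> S \<Longrightarrow> (\<lambda>t. trans_op t f x - \<eta>) sums h x"
    and "\<And>x. x \<in> S \<Longrightarrow> f x - \<eta> = h x - measure_pmf.expectation (K x) h"
proof -
  let ?\<pi> = "stationary_dist S K"
  have \<pi>: "stationary ?\<pi>" by (rule stationary_stationary_dist[OF erg ne])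
  obtain b where b: "summable b" and bound: "\<And>t p p'. set_pmf p \<subseteq> S \<Longrightarrow> set_pmf p' \<subseteq> S \<Longrightarrow>
      \<bar>measure_pmf.expectation p (trans_op t f) - measure_pmf.expectation p' (trans_op t f)\<bar> \<le> b t"
    using geometric_convergence[OF erg ne, of f] by blast
  define h where "h x = (\<Sum>t. trans_op t f x - \<eta>)" for x
  have "summable (\<lambda>t. trans_op t f x - \<eta>)" if "x \<in> S" for x
  proof (rule summable_comparison_test'[OF b])
    show "norm (trans_op t f x - \<eta>) \<le> b t" for t
      using bound[of "return_pmf x" ?\<pi> t] \<pi> that
      by (simp add: stationary_trans_op[OF \<pi>] stationary_def \<eta>_def)
  qed
  then have sums: "(\<lambda>t. trans_op t f x - \<eta>) sums h x" if "x \<in> S" for x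
    using that by (simp add: h_def summable_sums)
  have "f x - \<eta> = h x - measure_pmf.expectation (K x) h" if x: "x \<in> S" for x
  proof -
    have "(\<lambda>t. \<Sum>y\<in>S. pmf (K x) y * (trans_op t f y - \<eta>)) sums (\<Sum>y\<in>S. pmf (K x) y * h y)"
      by (intro sums_sum sums_mult sums)
    moreover have "(\<Sum>y\<in>S. pmf (K x) y * (trans_op t f y - \<eta>)) = trans_op (Suc t) f x - \<eta>" for t
    proof -
      have "trans_op (Suc t) f x = trans_op 1 (trans_op t f) x"
        using trans_op_add[OF x, of 1 t f] by simp
      also have "\<dots> = (\<Sum>y\<in>S. pmf (K x) y * trans_op t f y)"
        by (simp add: bind_return_pmf expectation_eq_sum[OF closed[OF x]])
      finally show ?thesis
        by (simp add: right_diff_distrib sum_subtractf sum_pmf_eq_1[OF finite_S closed[OF x]]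
            flip: sum_distrib_right)
    qed
    ultimately have "(\<lambda>t. trans_op (Suc t) f x - \<eta>) sums measure_pmf.expectation (K x) h"
      by (simp add: expectation_eq_sum[OF closed[OF x]])
    then have "(\<lambda>t. trans_op t f x - \<eta>) sums (measure_pmf.expectation (K x) h + (trans_op 0 f x - \<eta>))"
      by (rule sums_Suc)
    then have "h x = measure_pmf.expectation (K x) h + (trans_op 0 f x - \<eta>)"
      by (rule sums_unique2[OF sums[OF x]])
    then show ?thesis by simp
  qed
  with sums show thesis by (rule that)
qed

end


section \<open>The potential of a single player\<close>

lemma finite_chain_policy:
  assumes "finite S" "\<And>s. s \<in> S \<Longrightarrow> set_pmf (q s (f s)) \<subseteq> S"
  shows "finite_chain S (policy_kernel q f)"
  using assms by unfold_locales (auto simp: policy_kernel_def)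

lemma (in finite_chain) AE_long_run_average:
  fixes f :: "'x \<Rightarrow> real"
  assumes erg: "ergodic_chain S K" and \<nu>: "set_pmf \<nu> \<subseteq> S"
  shows "AE \<omega> in markov_law \<nu> K. long_run_average (\<lambda>t. f (\<omega> t)) =
    measure_pmf.expectation (stationary_dist S K) f"
proof -
  have ne: "S \<noteq> {}" using \<nu> set_pmf_not_empty by fastforce
  show ?thesis
    by (rule Poisson_solution[OF erg ne, where f = f]) (rule ergodic_theorem[OF \<nu>])
qed

lemma measurable_long_run_average [measurable]:
  "(\<lambda>\<omega>. long_run_average (\<lambda>t. f (\<omega> t))) \<in> borel_measurable (markov_law \<nu> K)"
  for f :: "'x \<Rightarrow> real"
  unfolding long_run_average_def by measurable

lemma integral_AE_const:
  fixes F :: "_ \<Rightarrow> real"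
  assumes "AE \<omega> in markov_law \<nu> K. F \<omega> = c" "F \<in> borel_measurable (markov_law \<nu> K)"
  shows "(\<integral>\<omega>. F \<omega> \<partial>markov_law \<nu> K) = c"
proof -
  interpret prob_space "markov_law \<nu> K" by (rule prob_space_markov_law)
  have "(\<integral>\<omega>. F \<omega> \<partial>markov_law \<nu> K) = (\<integral>\<omega>. c \<partial>markov_law \<nu> K)"
    using assms by (intro integral_cong_AE) auto
  then show ?thesis by (simp add: prob_space)
qed

text \<open>
  The expected partial sums that define the potential are the partial sums of the solution \<open>h\<close>
  constructed above. For this the pathwise variance under the initial state \<open>s\<close> has to be the
  stationary mean cost, whatever \<open>s\<close> is.
\<close>

lemma potential_Poisson:
  fixes \<rho> :: "'s \<Rightarrow> 'a \<Rightarrow> real" and y :: real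
  assumes chain: "finite_chain S (policy_kernel q f)" and erg: "ergodic_chain S (policy_kernel q f)"
    and s: "s \<in> S"
  defines "\<pi> \<equiv> stationary_dist S (policy_kernel q f)"
    and "g \<equiv> potential q \<rho> f y"
  shows "(\<rho> s (f s) - y)\<^sup>2 - measure_pmf.expectation \<pi> (\<lambda>s. (\<rho> s (f s) - y)\<^sup>2) =
    g s - (\<Sum>s'\<in>S. pmf (policy_kernel q f s) s' * g s')"
proof -
  interpret finite_chain S "policy_kernel q f" by (rule chain)
  let ?K = "policy_kernel q f" and ?c = "\<lambda>s. (\<rho> s (f s) - y)\<^sup>2"
  let ?\<eta> = "measure_pmf.expectation \<pi> ?c"
  have "S \<noteq> {}" using s by blast
  then obtain h where sums: "\<And>x. x \<in> S \<Longrightarrow> (\<lambda>t. trans_op t ?c x - ?\<eta>) sums h x"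
    and h: "\<And>x. x \<in> S \<Longrightarrow> ?c x - ?\<eta> = h x - measure_pmf.expectation (?K x) h"
    using Poisson_solution[OF erg, where f = ?c] unfolding \<pi>_def by blast
  have "g x = h x" if x: "x \<in> S" for x
  proof -
    have var: "player_variance q \<rho> f y x = ?\<eta>"
      unfolding player_variance_def \<pi>_def
      by (intro integral_AE_const AE_long_run_average[OF erg] measurable_long_run_average) (simp add: x)
    have "(\<integral>\<omega>. (\<Sum>t<N. ?c (\<omega> t) - ?\<eta>) \<partial>markov_law (return_pmf x) ?K) =
        (\<Sum>t<N. trans_op t ?c x - ?\<eta>)" for N
    proof -
      interpret prob_space "markov_law (return_pmf x) ?K" by (rule prob_space_markov_law)
      have int: "integrable (markov_law (return_pmf x) ?K) (\<lambda>\<omega>. ?c (\<omega> t))" for t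
        by (rule integrable_path[where t = t]) (use x in auto)
      have "(\<integral>\<omega>. ?c (\<omega> t) \<partial>markov_law (return_pmf x) ?K) = trans_op t ?c x" for t
        by (rule integral_coord[OF x, of ?c])
      with int show ?thesis
        by (simp add: prob_space)
    qed
    then show ?thesis
      unfolding g_def potential_def var using sums[OF x] by (simp add: sums_def limI)
  qed
  then show ?thesis
    using h[OF s] s by (simp add: expectation_eq_sum[OF closed[OF s]])
qed


section \<open>Mean and variance of the team\<close>

lemma joint_kernel_component:
  fixes h :: "'s \<Rightarrow> real"
  assumes "i \<in> {1..n}"
  shows "measure_pmf.expectation (joint_kernel n p u x) (\<lambda>x'. h (x' i)) =
    measure_pmf.expectation (policy_kernel (p i) (u i) (x i)) h"
proof -
  have "map_pmf (\<lambda>x'. x' i) (joint_kernel n p u x) = policy_kernel (p i) (u i) (x i)"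
    using assms by (simp add: joint_kernel_def policy_kernel_def Pi_pmf_component)
  then show ?thesis by (metis integral_map_pmf)
qed

lemma finite_chain_joint:
  assumes "\<And>i. i \<in> {1..n} \<Longrightarrow> finite_chain (S i) (policy_kernel (p i) (u i))"
  shows "finite_chain (\<Pi>\<^sub>E i\<in>{1..n}. S i) (joint_kernel n p u)"
proof
  show "finite (\<Pi>\<^sub>E i\<in>{1..n}. S i)"
    using assms by (intro finite_PiE) (auto simp: finite_chain_def)
  show "set_pmf (joint_kernel n p u x) \<subseteq> (\<Pi>\<^sub>E i\<in>{1..n}. S i)" if x: "x \<in> (\<Pi>\<^sub>E i\<in>{1..n}. S i)" for x
  proof
    fix z assume "z \<in> set_pmf (joint_kernel n p u x)"
    then have z: "z \<in> PiE_dflt {1..n} undefined (set_pmf \<circ> (\<lambda>i. p i (x i) (u i (x i))))"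
      by (simp add: joint_kernel_def set_Pi_pmf)
    have "set_pmf (p i (x i) (u i (x i))) \<subseteq> S i" if "i \<in> {1..n}" for i
      using finite_chain.closed[OF assms[OF that] PiE_mem[OF x that]] by (simp add: policy_kernel_def)
    then show "z \<in> (\<Pi>\<^sub>E i\<in>{1..n}. S i)"
      using z by (fastforce simp: PiE_dflt_def PiE_iff extensional_def)
  qed
qed

context
  fixes n :: nat and S :: "nat \<Rightarrow> 's set"
    and p :: "nat \<Rightarrow> 's \<Rightarrow> 'a \<Rightarrow> 's pmf" and u :: "nat \<Rightarrow> 's \<Rightarrow> 'a" and \<nu> :: "(nat \<Rightarrow> 's) pmf"
  assumes chain: "\<And>i. i \<in> {1..n} \<Longrightarrow> finite_chain (S i) (policy_kernel (p i) (u i))"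
    and erg: "\<And>i. i \<in> {1..n} \<Longrightarrow> ergodic_chain (S i) (policy_kernel (p i) (u i))"
    and \<nu>: "set_pmf \<nu> \<subseteq> (\<Pi>\<^sub>E i\<in>{1..n}. S i)"
begin

abbreviation stat_mean :: "nat \<Rightarrow> ('s \<Rightarrow> real) \<Rightarrow> real" where
  "stat_mean i f \<equiv> measure_pmf.expectation (stationary_dist (S i) (policy_kernel (p i) (u i))) f"

text \<open>
  The kernel of the joint chain acts on functions of the \<open>i\<close>-th coordinate as player \<open>i\<close>'s kernel does, so
  player \<open>i\<close>'s solution of the Poisson equation is also one for the joint chain.
\<close>

lemma AE_team_average:
  assumes i: "i \<in> {1..n}"
  shows "AE \<omega> in team_law n p \<nu> u. long_run_average (\<lambda>t. f (\<omega> t i)) = stat_mean i f"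
proof -
  interpret J: finite_chain "\<Pi>\<^sub>E i\<in>{1..n}. S i" "joint_kernel n p u"
    by (rule finite_chain_joint[OF chain])
  interpret I: finite_chain "S i" "policy_kernel (p i) (u i)" by (rule chain[OF i])
  obtain x where "x \<in> set_pmf \<nu>" using set_pmf_not_empty by fast
  then have "S i \<noteq> {}" using \<nu> i by (auto simp: PiE_iff)
  then obtain h where h: "\<And>s. s \<in> S i \<Longrightarrow>
      f s - stat_mean i f = h s - measure_pmf.expectation (policy_kernel (p i) (u i) s) h"
    using I.Poisson_solution[OF erg[OF i], where f = f] by blast
  show ?thesis
    unfolding team_law_def
  proof (rule J.ergodic_theorem[OF \<nu>])
    fix x assume "x \<in> (\<Pi>\<^sub>E i\<in>{1..n}. S i)"
    then have "x i \<in> S i" using i by (rule PiE_mem)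
    then show "f (x i) - stat_mean i f =
        h (x i) - measure_pmf.expectation (joint_kernel n p u x) (\<lambda>x'. h (x' i))"
      unfolding joint_kernel_component[OF i] by (rule h)
  qed
qed

lemma integral_team_sum:
  "(\<integral>\<omega>. c * (\<Sum>i=1..n. long_run_average (\<lambda>t. f i (\<omega> t i))) \<partial>team_law n p \<nu> u) =
    c * (\<Sum>i=1..n. stat_mean i (f i))"
  unfolding team_law_def
proof (rule integral_AE_const)
  have "AE \<omega> in team_law n p \<nu> u. \<forall>i\<in>{1..n}. long_run_average (\<lambda>t. f i (\<omega> t i)) = stat_mean i (f i)"
    by (intro AE_finite_allI AE_team_average) auto
  then show "AE \<omega> in markov_law \<nu> (joint_kernel n p u).
      c * (\<Sum>i=1..n. long_run_average (\<lambda>t. f i (\<omega> t i))) = c * (\<Sum>i=1..n. stat_mean i (f i))"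
    unfolding team_law_def by eventually_elim simp
  have "(\<lambda>\<omega>. long_run_average (\<lambda>t. f i (\<omega> t i))) \<in> borel_measurable (markov_law \<nu> (joint_kernel n p u))" for i
    by (rule measurable_long_run_average[where f = "\<lambda>x. f i (x i)"])
  then show "(\<lambda>\<omega>. c * (\<Sum>i=1..n. long_run_average (\<lambda>t. f i (\<omega> t i))))
      \<in> borel_measurable (markov_law \<nu> (joint_kernel n p u))"
    by (intro borel_measurable_times borel_measurable_sum borel_measurable_const)
qed

lemma team_mean_eq:
  "team_mean n p r \<nu> u = 1 / real n * (\<Sum>i=1..n. stat_mean i (\<lambda>s. r i s (u i s)))"
  unfolding team_mean_def by (rule integral_team_sum)

lemma team_variance_eq:
  "team_variance n p r \<nu> u = (\<Sum>i=1..n. stat_mean i (\<lambda>s. (r i s (u i s) - team_mean n p r \<nu> u)\<^sup>2))"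
  using integral_team_sum[of 1 "\<lambda>i s. (r i s (u i s) - team_mean n p r \<nu> u)\<^sup>2"]
  by (simp add: team_variance_def)

text \<open>
  Expanding \<open>(r - y)\<^sup>2\<close> around the team mean leaves a cross term that is proportional to the sum over the
  players of (own mean minus team mean). It does not vanish for each player, only in the sum.
\<close>

lemma team_variance_shift:
  assumes n: "n \<ge> 1"
  shows "team_variance n p r \<nu> u = (\<Sum>i=1..n. stat_mean i (\<lambda>s. (r i s (u i s) - y)\<^sup>2))
    - real n * (team_mean n p r \<nu> u - y)\<^sup>2"
proof -
  let ?\<mu> = "team_mean n p r \<nu> u" and ?m = "\<lambda>i. stat_mean i (\<lambda>s. r i s (u i s))"
  have shift: "stat_mean i (\<lambda>s. (r i s (u i s) - y)\<^sup>2) =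
      stat_mean i (\<lambda>s. (r i s (u i s) - ?\<mu>)\<^sup>2) + 2 * (?\<mu> - y) * (?m i - ?\<mu>) + (?\<mu> - y)\<^sup>2"
    if i: "i \<in> {1..n}" for i
  proof -
    interpret finite_chain "S i" "policy_kernel (p i) (u i)" by (rule chain[OF i])
    obtain x where "x \<in> set_pmf \<nu>" using set_pmf_not_empty by fast
    then have "S i \<noteq> {}" using \<nu> i by (auto simp: PiE_iff)
    then have st: "set_pmf (stationary_dist (S i) (policy_kernel (p i) (u i))) \<subseteq> S i"
      using stationary_stationary_dist[OF erg[OF i]] by (simp add: stationary_def)
    have "(r i s (u i s) - y)\<^sup>2 = (r i s (u i s) - ?\<mu>)\<^sup>2
        + 2 * (?\<mu> - y) * (r i s (u i s) - ?\<mu>) + (?\<mu> - y)\<^sup>2" for s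
      by (simp add: power2_eq_square algebra_simps)
    moreover have "integrable (measure_pmf (stationary_dist (S i) (policy_kernel (p i) (u i)))) f"
      for f :: "'s \<Rightarrow> real"
      using st finite_S by (intro integrable_measure_pmf_finite) (auto intro: finite_subset)
    ultimately show ?thesis by simp
  qed
  have "(\<Sum>i=1..n. ?m i) = real n * ?\<mu>"
    using n by (simp add: team_mean_eq)
  then have "(\<Sum>i=1..n. 2 * (?\<mu> - y) * (?m i - ?\<mu>)) = 0"
    by (simp add: sum_subtractf flip: sum_distrib_left)
  then show ?thesis
    by (simp add: shift sum.distrib team_variance_eq)
qed

end


section \<open>The variance difference formula\<close>

theorem mainTheorem3:
  fixes n :: nat
    and S :: "nat \<Rightarrow> 's set"
    and A :: "nat \<Rightarrow> 'a set"
    and p :: "nat \<Rightarrow> 's \<Rightarrow> 'a \<Rightarrow> 's pmf"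
    and r :: "nat \<Rightarrow> 's \<Rightarrow> 'a \<Rightarrow> real"
    and \<nu> \<nu>' :: "(nat \<Rightarrow> 's) pmf"
    and u u' :: "nat \<Rightarrow> 's \<Rightarrow> 'a"
  assumes players: "n \<ge> 1"
    and finite_states: "\<And>i. i \<in> {1..n} \<Longrightarrow> finite (S i)"
    and finite_actions: "\<And>i. i \<in> {1..n} \<Longrightarrow> finite (A i)"
    and transitions: "\<And>i s a. i \<in> {1..n} \<Longrightarrow> s \<in> S i \<Longrightarrow> a \<in> A i \<Longrightarrow> set_pmf (p i s a) \<subseteq> S i"
    and ergodic: "\<And>i f. i \<in> {1..n} \<Longrightarrow> f \<in> S i \<rightarrow>\<^sub>E A i \<Longrightarrow> ergodic_chain (S i) (policy_kernel (p i) f)"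
    and initial: "set_pmf \<nu> \<subseteq> (\<Pi>\<^sub>E i\<in>{1..n}. S i)"
    and initial': "set_pmf \<nu>' \<subseteq> (\<Pi>\<^sub>E i\<in>{1..n}. S i)"
    and policy: "u \<in> SD_policies n S A"
    and policy': "u' \<in> SD_policies n S A"
  shows "team_variance n p r \<nu>' u' - team_variance n p r \<nu> u =
    (\<Sum>i=1..n. \<Sum>s\<in>S i. pmf (stationary_dist (S i) (policy_kernel (p i) (u' i))) s *
        ((\<Sum>s'\<in>S i. (pmf (policy_kernel (p i) (u' i) s) s' - pmf (policy_kernel (p i) (u i) s) s')
              * potential (p i) (r i) (u i) (team_mean n p r \<nu> u) s')
          + (r i s (u' i s) - team_mean n p r \<nu> u)\<^sup>2 - (r i s (u i s) - team_mean n p r \<nu> u)\<^sup>2))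
    - real n * (team_mean n p r \<nu>' u' - team_mean n p r \<nu> u)\<^sup>2"
proof -
  let ?\<mu> = "team_mean n p r \<nu> u"
  let ?K = "\<lambda>v i. policy_kernel (p i) (v i)"
  let ?\<pi> = "\<lambda>v i. stationary_dist (S i) (?K v i)"
  let ?c = "\<lambda>v i s. (r i s (v i s) - ?\<mu>)\<^sup>2"
  let ?g = "\<lambda>i. potential (p i) (r i) (u i) ?\<mu>"
  let ?E = "\<lambda>v i. measure_pmf.expectation (?\<pi> v i) (?c v i)"
  have mem: "v i \<in> S i \<rightarrow>\<^sub>E A i" if "v \<in> SD_policies n S A" "i \<in> {1..n}" for v i
    using that unfolding SD_policies_def by (rule PiE_mem)
  have chain: "finite_chain (S i) (?K v i)" if v: "v \<in> SD_policies n S A" and i: "i \<in> {1..n}" for v i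
    using transitions[OF i] PiE_mem[OF mem[OF v i]]
    by (intro finite_chain_policy finite_states[OF i]) blast
  have erg: "ergodic_chain (S i) (?K v i)" if v: "v \<in> SD_policies n S A" and i: "i \<in> {1..n}" for v i
    by (rule ergodic[OF i mem[OF v i]])
  have player: "?E u' i - ?E u i = (\<Sum>s\<in>S i. pmf (?\<pi> u' i) s *
      ((\<Sum>s'\<in>S i. (pmf (?K u' i s) s' - pmf (?K u i s) s') * ?g i s') + ?c u' i s - ?c u i s))"
    if i: "i \<in> {1..n}" for i
  proof -
    interpret C: finite_chain "S i" "?K u' i" by (rule chain[OF policy' i])
    obtain x where "x \<in> set_pmf \<nu>" using set_pmf_not_empty by fast
    then have "S i \<noteq> {}" using initial i by (auto simp: PiE_iff)
    then have "C.stationary (?\<pi> u' i)" by (rule C.stationary_stationary_dist[OF erg[OF policy' i]])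
    then have supp: "set_pmf (?\<pi> u' i) \<subseteq> S i"
      and inv: "\<And>y. y \<in> S i \<Longrightarrow> (\<Sum>s\<in>S i. pmf (?\<pi> u' i) s * pmf (?K u' i s) y) = pmf (?\<pi> u' i) y"
      by (simp_all add: C.stationary_def)
    let ?w = "pmf (?\<pi> u' i)"
    \<comment> \<open>Stationarity of \<open>\<pi>\<^sub>i'\<close>: \<open>\<pi>\<^sub>i' P\<^sub>i' g\<^sub>i = \<pi>\<^sub>i' g\<^sub>i\<close>.\<close>
    have "(\<Sum>s\<in>S i. ?w s * (\<Sum>s'\<in>S i. pmf (?K u' i s) s' * ?g i s')) =
        (\<Sum>s'\<in>S i. (\<Sum>s\<in>S i. ?w s * pmf (?K u' i s) s') * ?g i s')"
      unfolding sum_distrib_left sum_distrib_right mult.assoc by (rule sum.swap)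
    also have "\<dots> = (\<Sum>s\<in>S i. ?w s * ?g i s)"
      by (simp add: inv)
    finally have swap: "(\<Sum>s\<in>S i. ?w s * (\<Sum>s'\<in>S i. pmf (?K u' i s) s' * ?g i s')) =
        (\<Sum>s\<in>S i. ?w s * ?g i s)" .
    \<comment> \<open>The Poisson equation replaces \<open>- P\<^sub>i g\<^sub>i - c\<^sub>i\<close> by \<open>- g\<^sub>i - \<pi>\<^sub>i c\<^sub>i\<close>.\<close>
    have summand: "(\<Sum>s'\<in>S i. (pmf (?K u' i s) s' - pmf (?K u i s) s') * ?g i s') + ?c u' i s - ?c u i s =
        (\<Sum>s'\<in>S i. pmf (?K u' i s) s' * ?g i s') - ?g i s + ?c u' i s - ?E u i" if s: "s \<in> S i" for s
      using potential_Poisson[OF chain[OF policy i] erg[OF policy i] s, of "r i" ?\<mu>]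
      by (simp add: left_diff_distrib sum_subtractf)
    have "(\<Sum>s\<in>S i. ?w s *
        ((\<Sum>s'\<in>S i. (pmf (?K u' i s) s' - pmf (?K u i s) s') * ?g i s') + ?c u' i s - ?c u i s)) =
      (\<Sum>s\<in>S i. ?w s * ((\<Sum>s'\<in>S i. pmf (?K u' i s) s' * ?g i s') - ?g i s + ?c u' i s - ?E u i))"
      by (rule sum.cong) (simp_all only: summand)
    also have "\<dots> = (\<Sum>s\<in>S i. ?w s * (\<Sum>s'\<in>S i. pmf (?K u' i s) s' * ?g i s')) -
        (\<Sum>s\<in>S i. ?w s * ?g i s) + (\<Sum>s\<in>S i. ?w s * ?c u' i s) - (\<Sum>s\<in>S i. ?w s) * ?E u i"
      by (simp only: right_diff_distrib distrib_left sum_subtractf sum.distrib sum_distrib_right)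
    also have "\<dots> = ?E u' i - ?E u i"
      unfolding swap C.expectation_eq_sum[OF supp] sum_pmf_eq_1[OF C.finite_S supp] by simp
    finally show ?thesis by (rule sym)
  qed
  have "team_variance n p r \<nu>' u' - team_variance n p r \<nu> u =
      (\<Sum>i=1..n. ?E u' i - ?E u i) - real n * (team_mean n p r \<nu>' u' - ?\<mu>)\<^sup>2"
    using team_variance_shift[OF chain[OF policy'] erg[OF policy'] initial' players, of r ?\<mu>]
      team_variance_eq[OF chain[OF policy] erg[OF policy] initial, of r]
    by (simp add: sum_subtractf)
  also have "(\<Sum>i=1..n. ?E u' i - ?E u i) = (\<Sum>i=1..n. \<Sum>s\<in>S i. pmf (?\<pi> u' i) s *
      ((\<Sum>s'\<in>S i. (pmf (?K u' i s) s' - pmf (?K u i s) s') * ?g i s') + ?c u' i s - ?c u i s))"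
    by (rule sum.cong) (simp_all only: player)
  finally show ?thesis .
qed

end
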